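(* Let $\mathbb{F}=\mathbb{R},\mathbb{C}$, or $\mathbb{H}$, let $n\geq1$, let $G$ be a finite subgroup of the unit sphere $S(\mathbb{F})=\{u\in\mathbb{F}:|u|=1\}$ (a group under multiplication), and let $H$ be a nontrivial subgroup of $G$ of index $k$. Let $g_1,\ldots,g_k$ be representatives of the left cosets $g_1H,\ldots,g_kH$ of $H$ in $G$. Given any $n$ $\mathbb{F}$-valued mass distributions $\mu_1,\ldots,\mu_n$ on $\mathbb{F}^{kn}$ and any $kn$ automorphisms $\varphi_{\ell,i}\in\mathrm{Aut}(H)$, $1\leq\ell\leq k$, $1\leq i\leq n$, there exists a $G$-Voronoi partition $\{\mathcal{R}_g\}_{g\in G}=\{\mathcal{R}_g(\mathbf{a},b)\}_{g\in G}$ of $\mathbb{F}^{kn}$ (for some $(\mathbf{a},b)\in S(\mathbb{F}^{kn})\times\mathbb{F}$) such that $$\sum_{h\in H}\varphi_{\ell,i}(h)^{-1}\mu_i(\mathcal{R}_{g_\ell h})=0$$ for each $1\leq\ell\leq k$ and $1\leq i\leq n$.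
   Context: $\mathbb{H}$ denotes the quaternions, $d=\dim_{\mathbb{R}}\mathbb{F}\in\{1,2,4\}$, and $\mathbb{F}^N$ is identified with $\mathbb{R}^{dN}$; $S(\mathbb{F}^N)$ is the unit sphere of $\mathbb{F}^N$ for the Euclidean norm. Scalars act on $\mathbb{F}^N$ by left multiplication, and $\langle\mathbf{u},\mathbf{v}\rangle_{\mathbb{F}}=\sum_i u_i\bar v_i$. An $\mathbb{F}$-valued mass distribution on $\mathbb{F}^N$ is a function $\mu$ from the Borel sets of $\mathbb{F}^N$ to $\mathbb{F}$ such that (i) $\mu(\emptyset)=0$; (ii) $\mu(\bigcup_{i=1}^\infty E_i)=\sum_{i=1}^\infty\mu(E_i)$ for every countable collection of disjoint Borel sets, the sum converging absolutely in the Euclidean norm on $\mathbb{F}$; (iii) for each real (affine) hyperplane $H'\subseteq\mathbb{R}^{dN}=\mathbb{F}^N$, $\mu(E)=0$ for every Borel set $E\subseteq H'$; (iv) $\mu(\mathbb{F}^N)\neq0$. For $(\mathbf{a},b)\in S(\mathbb{F}^N)\times\mathbb{F}$, the associated $G$-Voronoi partition of $\mathbb{F}^N$ is the collection $\{\mathcal{R}_g(\mathbf{a},b)\}_{g\in G}$ of the Voronoi regions of the $|G|$ points $\bar b\mathbf{a}+g\mathbf{a}$, $g\in G$: $$\mathcal{R}_g(\mathbf{a},b)=\{\mathbf{u}\in\mathbb{F}^N : \|\mathbf{u}-\bar b\mathbf{a}-g\mathbf{a}\|\leq\|\mathbf{u}-\bar b\mathbf{a}-g'\mathbf{a}\|\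 \ \forall g'\in G\}.$$ Equivalently, $\mathcal{R}_g(\mathbf{a},b)=\{\mathbf{u} : \langle\mathbf{u},\mathbf{a}\rangle_{\mathbb{F}}=\bar b+v \text{ for some } v\in R_g\}$, where $R_g=\{v\in\mathbb{F}: |v-g|\leq|v-g'|\ \forall g'\in G\}$. The word "partition" allows overlaps along boundaries. *)

theory Defs
  imports "HOL-Analysis.Analysis" "HOL-Algebra.Left_Coset"
begin

text \<open>\<open>Quat a b c d\<close> is \<open>a + b i + c j + d k\<close>.\<close>

datatype quat = Quat (quat_re: real) (quat_i: real) (quat_j: real) (quat_k: real)

lemma quat_eq_iff:
  "x = y \<longleftrightarrow> quat_re x = quat_re y \<and> quat_i x = quat_i y \<and> quat_j x = quat_j y \<and> quat_k x = quat_k y"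
  by (cases x; cases y) simp

instantiation quat :: ab_group_add
begin

definition "0 = Quat 0 0 0 0"
definition "x + y = Quat (quat_re x + quat_re y) (quat_i x + quat_i y) (quat_j x + quat_j y) (quat_k x + quat_k y)"
definition "- x = Quat (- quat_re x) (- quat_i x) (- quat_j x) (- quat_k x)"
definition "x - y = Quat (quat_re x - quat_re y) (quat_i x - quat_i y) (quat_j x - quat_j y) (quat_k x - quat_k y)"

instance
  by standard (simp_all add: zero_quat_def plus_quat_def uminus_quat_def minus_quat_def)

end

instantiation quat :: ring_1
begin

definition "1 = Quat 1 0 0 0"

definition "x * y = Quat
  (quat_re x * quat_re y - quat_i x * quat_i y - quat_j x * quat_j y - quat_k x * quat_k y)
  (quat_re x * quat_i y + quat_i x * quat_re y + quat_j x * quat_k y - quat_k x * quat_j y)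
  (quat_re x * quat_j y - quat_i x * quat_k y + quat_j x * quat_re y + quat_k x * quat_i y)
  (quat_re x * quat_k y + quat_i x * quat_j y - quat_j x * quat_i y + quat_k x * quat_re y)"

instance
  by standard
    (simp_all add: zero_quat_def one_quat_def plus_quat_def times_quat_def algebra_simps)

end

instantiation quat :: real_algebra_1
begin

definition "scaleR r x = Quat (r * quat_re x) (r * quat_i x) (r * quat_j x) (r * quat_k x)"

instance
  by standard (simp_all add: scaleR_quat_def plus_quat_def times_quat_def algebra_simps)

end

instantiation quat :: real_inner
begin

definition "inner x y =
  quat_re x * quat_re y + quat_i x * quat_i y + quat_j x * quat_j y + quat_k x * quat_k y"

definition "norm x = sqrt ((quat_re x)\<^sup>2 + (quat_i x)\<^sup>2 + (quat_j x)\<^sup>2 + (quat_k x)\<^sup>2)"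

definition "sgn x = x /\<^sub>R norm x" for x :: quat

definition "dist x y = norm (x - y)" for x y :: quat

definition [code del]:
  "(uniformity :: (quat \<times> quat) filter) = (INF e\<in>{0 <..}. principal {(x, y). dist x y < e})"

definition [code del]:
  "open U \<longleftrightarrow> (\<forall>x\<in>U. eventually (\<lambda>(x', y). x' = x \<longrightarrow> y \<in> U) uniformity)" for U :: "quat set"

instance
proof
  fix x y z :: quat and r :: real
  show "inner x x = 0 \<longleftrightarrow> x = 0"
  proof
    assume "inner x x = 0"
    then have *: "(quat_re x)\<^sup>2 + (quat_i x)\<^sup>2 + (quat_j x)\<^sup>2 + (quat_k x)\<^sup>2 = 0"
      by (simp add: inner_quat_def power2_eq_square)
    have "(quat_re x)\<^sup>2 = 0" "(quat_i x)\<^sup>2 = 0" "(quat_j x)\<^sup>2 = 0" "(quat_k x)\<^sup>2 = 0"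
      using * zero_le_power2[of "quat_re x"] zero_le_power2[of "quat_i x"]
        zero_le_power2[of "quat_j x"] zero_le_power2[of "quat_k x"] by linarith+
    then show "x = 0" by (simp add: quat_eq_iff zero_quat_def)
  qed (simp add: inner_quat_def zero_quat_def)
qed (simp_all add: inner_quat_def norm_quat_def plus_quat_def scaleR_quat_def sgn_quat_def
      dist_quat_def uniformity_quat_def open_quat_def power2_eq_square algebra_simps)

end

instantiation quat :: euclidean_space
begin

definition "Basis = {Quat 1 0 0 0, Quat 0 1 0 0, Quat 0 0 1 0, Quat 0 0 0 1}"

instance
  by standard (auto simp: Basis_quat_def inner_quat_def zero_quat_def intro!: quat.expand)

end

instantiation quat :: real_normed_div_algebra
begin

definition "inverse x =
  Quat (quat_re x) (- quat_i x) (- quat_j x) (- quat_k x) /\<^sub>R (norm x)\<^sup>2" for x :: quat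

definition "x div y = x * inverse y" for x y :: quat

instance
proof
  fix x y :: quat
  have n2: "(norm x)\<^sup>2 = quat_re x * quat_re x + quat_i x * quat_i x + quat_j x * quat_j x + quat_k x * quat_k x"
    for x :: quat
    by (simp add: norm_quat_def power2_eq_square)
  show "inverse (0::quat) = 0"
    by (simp add: inverse_quat_def)
  show "x div y = x * inverse y"
    by (rule divide_quat_def)
  show "norm (x * y) = norm x * norm y"
  proof -
    have "(norm (x * y))\<^sup>2 = (norm x * norm y)\<^sup>2"
      unfolding power_mult_distrib n2 times_quat_def quat.sel by algebra
    then show ?thesis
      by (rule power2_eq_imp_eq) simp_all
  qed
  assume "x \<noteq> 0"
  then have nz: "(norm x)\<^sup>2 \<noteq> 0" by simp
  let ?c = "Quat (quat_re x) (- quat_i x) (- quat_j x) (- quat_k x)"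
  have "?c * x = (norm x)\<^sup>2 *\<^sub>R 1" "x * ?c = (norm x)\<^sup>2 *\<^sub>R 1"
    by (simp_all add: n2 times_quat_def scaleR_quat_def one_quat_def algebra_simps)
  then show "inverse x * x = 1" "x * inverse x = 1"
    using nz by (simp_all add: inverse_quat_def)
qed

end

text \<open>The axiom determines the conjugation: it gives \<open>scalar_cnj x = (norm x)\<^sup>2 * inverse x\<close>
  for \<open>x \<noteq> 0\<close>.  The instances below are the usual conjugations.\<close>

class conj_div_algebra = real_normed_div_algebra + euclidean_space +
  fixes scalar_cnj :: "'a \<Rightarrow> 'a"
  assumes mult_scalar_cnj: "x * scalar_cnj x = (norm x)\<^sup>2 *\<^sub>R 1"
    and scalar_cnj_zero: "scalar_cnj 0 = 0"

instantiation real :: conj_div_algebra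
begin
definition "scalar_cnj x = x" for x :: real
instance by standard (simp_all add: scalar_cnj_real_def power2_eq_square)
end

instantiation complex :: conj_div_algebra
begin
definition "scalar_cnj x = cnj x" for x :: complex
instance
proof
  fix x :: complex
  show "x * scalar_cnj x = (norm x)\<^sup>2 *\<^sub>R 1"
    using complex_norm_square[of x] by (simp add: scalar_cnj_complex_def scaleR_conv_of_real)
qed (simp add: scalar_cnj_complex_def)
end

instantiation quat :: conj_div_algebra
begin
definition "scalar_cnj x = Quat (quat_re x) (- quat_i x) (- quat_j x) (- quat_k x)"
instance
proof
  fix x :: quat
  have "(norm x)\<^sup>2 = quat_re x * quat_re x + quat_i x * quat_i x + quat_j x * quat_j x + quat_k x * quat_k x"
    by (simp add: norm_quat_def power2_eq_square)
  then show "x * scalar_cnj x = (norm x)\<^sup>2 *\<^sub>R 1"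
    by (simp add: scalar_cnj_quat_def times_quat_def scaleR_quat_def one_quat_def)
qed (simp add: scalar_cnj_quat_def zero_quat_def)
end

definition mult_monoid :: "'f::conj_div_algebra set \<Rightarrow> 'f monoid"
  where "mult_monoid A = \<lparr>carrier = A, mult = (*), one = 1\<rparr>"

abbreviation unit_sphere_group :: "'f::conj_div_algebra monoid"
  where "unit_sphere_group \<equiv> mult_monoid (sphere 0 1)"

lemma mult_monoid_simps [simp]:
  "carrier (mult_monoid A) = A"
  "x \<otimes>\<^bsub>mult_monoid A\<^esub> y = x * y"
  "\<one>\<^bsub>mult_monoid A\<^esub> = 1"
  by (simp_all add: mult_monoid_def)

lemma group_unit_sphere: "group (unit_sphere_group :: 'f::conj_div_algebra monoid)"
proof (rule groupI)
  fix x y z :: 'f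
  show "\<one>\<^bsub>unit_sphere_group\<^esub> \<in> carrier (unit_sphere_group :: 'f monoid)"
    by simp
  show "\<one>\<^bsub>unit_sphere_group\<^esub> \<otimes>\<^bsub>unit_sphere_group\<^esub> x = x"
    by simp
  show "x \<otimes>\<^bsub>unit_sphere_group\<^esub> y \<otimes>\<^bsub>unit_sphere_group\<^esub> z =
      x \<otimes>\<^bsub>unit_sphere_group\<^esub> (y \<otimes>\<^bsub>unit_sphere_group\<^esub> z)"
    by (simp add: semigroup_mult_class.mult.assoc)
  assume "x \<in> carrier unit_sphere_group"
  then have x: "norm x = 1" by simp
  then have "x \<noteq> 0" by auto
  with x have "inverse x \<in> carrier unit_sphere_group"
    "inverse x \<otimes>\<^bsub>unit_sphere_group\<^esub> x = \<one>\<^bsub>unit_sphere_group\<^esub>"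
    by (simp_all add: norm_inverse)
  then show "\<exists>y\<in>carrier unit_sphere_group. y \<otimes>\<^bsub>unit_sphere_group\<^esub> x = \<one>\<^bsub>unit_sphere_group\<^esub>"
    by blast
  assume "y \<in> carrier unit_sphere_group"
  with x show "x \<otimes>\<^bsub>unit_sphere_group\<^esub> y \<in> carrier unit_sphere_group"
    by (simp add: norm_mult)
qed

definition left_coset_reps :: "('a, 'b) monoid_scheme \<Rightarrow> 'a set \<Rightarrow> nat \<Rightarrow> (nat \<Rightarrow> 'a) \<Rightarrow> bool"
  where "left_coset_reps G H k g \<longleftrightarrow>
    (\<forall>l\<in>{1..k}. g l \<in> carrier G) \<and>
    bij_betw (\<lambda>l. g l <#\<^bsub>G\<^esub> H) {1..k} (lcosets\<^bsub>G\<^esub> H)"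

text \<open>Only the values of \<open>\<mu>\<close> on Borel sets matter.  The inner product on \<open>'f ^ 'm\<close> is the real
  one, so the sets \<open>{u. w \<bullet> u = c}\<close> are the real affine hyperplanes.\<close>

definition mass_distribution :: "(('f::conj_div_algebra ^ 'm::finite) set \<Rightarrow> 'f) \<Rightarrow> bool"
  where "mass_distribution \<mu> \<longleftrightarrow>
    \<mu> {} = 0 \<and>
    (\<forall>E :: nat \<Rightarrow> ('f ^ 'm) set. range E \<subseteq> sets borel \<and> disjoint_family E \<longrightarrow>
      summable (\<lambda>i. norm (\<mu> (E i))) \<and> (\<lambda>i. \<mu> (E i)) sums \<mu> (\<Union>i. E i)) \<and>
    (\<forall>w c E. w \<noteq> 0 \<and> E \<in> sets borel \<and> E \<subseteq> {u. w \<bullet> u = c} \<longrightarrow> \<mu> E = 0) \<and>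
    \<mu> UNIV \<noteq> 0"

text \<open>\<open>*s\<close> multiplies each coordinate by the scalar on the left, and the norm on \<open>'f ^ 'm\<close> is
  the Euclidean one.\<close>

definition voronoi_region ::
    "'f::conj_div_algebra set \<Rightarrow> 'f ^ 'm::finite \<Rightarrow> 'f \<Rightarrow> 'f \<Rightarrow> ('f ^ 'm) set"
  where "voronoi_region G a b g =
    {u. \<forall>g'\<in>G. norm (u - scalar_cnj b *s a - g *s a) \<le> norm (u - scalar_cnj b *s a - g' *s a)}"

end

theory Submission
  imports Defs "HOL-Library.Poly_Mapping"
begin

text \<open>Put \<open>b = -t/|a|\<close> with \<open>t = 1 - |a|\<close> and let \<open>a\<close> run through the closed unit ball.  The sums in
  question define a continuous map of the ball which does not vanish at the centre, where the region
  of \<open>1\<close> is everything.  On the sphere, where \<open>b = 0\<close>, a fixed \<open>z \<in> H - {1}\<close> of order \<open>p\<close> acts on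
  the source by left multiplication and on each coordinate of the target by left multiplication with
  \<open>\<phi>(z)\<close>, and the map is equivariant.  So a Borsuk--Ulam theorem for free linear actions of
  \<open>\<int>/p\<close> gives a zero \<open>a \<noteq> 0\<close>.

  The Borsuk--Ulam theorem is proved with chains of tuples of nearby points.  The sphere is
  filtered by invariant sets, each contractible in the next; discrete prisms along the
  contractions yield fine chains \<open>c 0, c 1, \<dots>\<close> with \<open>\<partial> c (i + 1) = (1 - T) (c i)\<close> or
  \<open>(1 + T + \<dots> + T^(p-1)) (c i)\<close>, the last one filling the ball.  A zero-free equivariant map labels
  points by pairs (index, element of \<open>\<int>/p\<close>) with as many indices as the real dimension, and nearby
  points with the same index get the same group element.  The generators of the cohomology
  of \<open>\<int>/p\<close> take values \<open>\<plusminus>1\<close> modulo \<open>p\<close> on the labelled chains, but a label tuple longer than the number of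
  indices is degenerate.\<close>

subsection \<open>Chains of tuples\<close>

text \<open>The order \<open>p\<close> may be composite, so the argument cannot pass to a field with
  \<open>p\<close> elements: cochains are integer valued, and the step that cancels \<open>p\<close>
  is carried out in the integers. It matters that the maps \<phi> are automorphisms:
  \<open>\<phi> z\<close> then has exact order \<open>p\<close> again, whereas a homomorphism could
  send \<open>z\<close> to \<open>1\<close> and leave the target without a free action. Chains are
  chosen with small mesh from the start, so neither triangulations nor subdivision occur. The price
  is that tuples are ordered and may repeat an index; only after sorting with signs does a tuple
  longer than the number of indices vanish. Sorting respects the boundary only where equal indices
  force equal labels, which is what the mesh guarantees. Each complex line of the target must supply
  exactly two indices. This comes from halving a fundamental domain of the rotation. A quaternionic
  line supplies four, because left multiplication by a quaternion is multiplication by a complex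
  number in suitable coordinates.\<close>

type_synonym 'a chain = "'a list \<Rightarrow>\<^sub>0 int"

definition cone_chain :: "'a \<Rightarrow> 'a chain \<Rightarrow> 'a chain"
  where "cone_chain x = frag_extend (\<lambda>L. frag_of (x # L))"

text \<open>The empty list is kept, so this is the augmented complex: \<open>bd_list [x] = frag_of []\<close>.\<close>

primrec bd_list :: "'a list \<Rightarrow> 'a chain" where
  "bd_list [] = 0"
| "bd_list (x # L) = frag_of L - cone_chain x (bd_list L)"

definition bd :: "'a chain \<Rightarrow> 'a chain"
  where "bd = frag_extend bd_list"

definition map_chain :: "('a \<Rightarrow> 'b) \<Rightarrow> 'a chain \<Rightarrow> 'b chain"
  where "map_chain f = frag_extend (\<lambda>L. frag_of (map f L))"

text \<open>\<open>frag_extend\<close> takes values in a free abelian group, so the integers appear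
  here as the free group on \<open>()\<close>.\<close>

definition eval_chain :: "('a list \<Rightarrow> int) \<Rightarrow> 'a chain \<Rightarrow> int"
  where "eval_chain f c = Poly_Mapping.lookup (frag_extend (\<lambda>L. frag_cmul (f L) (frag_of ())) c) ()"

lemma cone_simps [simp]:
  "cone_chain x 0 = 0" "cone_chain x (frag_of L) = frag_of (x # L)"
  "cone_chain x (c - d) = cone_chain x c - cone_chain x d" "cone_chain x (c + d) = cone_chain x c + cone_chain x d"
  "cone_chain x (- c) = - cone_chain x c"
  by (simp_all add: cone_chain_def frag_extend_diff frag_extend_add frag_extend_minus)

lemma bd_simps [simp]:
  "bd 0 = 0" "bd (frag_of L) = bd_list L"
  "bd (c - d) = bd c - bd d" "bd (c + d) = bd c + bd d" "bd (- c) = - bd c"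
  by (simp_all add: bd_def frag_extend_diff frag_extend_add frag_extend_minus)

lemma map_chain_simps [simp]:
  "map_chain f 0 = 0" "map_chain f (frag_of L) = frag_of (map f L)"
  "map_chain f (c - d) = map_chain f c - map_chain f d"
  "map_chain f (c + d) = map_chain f c + map_chain f d"
  "map_chain f (- c) = - map_chain f c"
  by (simp_all add: map_chain_def frag_extend_diff frag_extend_add frag_extend_minus)

lemma eval_chain_simps [simp]:
  "eval_chain f 0 = 0" "eval_chain f (frag_of L) = f L"
  "eval_chain f (c - d) = eval_chain f c - eval_chain f d"
  "eval_chain f (c + d) = eval_chain f c + eval_chain f d"
  "eval_chain f (- c) = - eval_chain f c"
  by (simp_all add: eval_chain_def frag_extend_diff frag_extend_add frag_extend_minus lookup_add lookup_minus)

lemma bd_sum: "bd (\<Sum>i\<in>I. c i) = (\<Sum>i\<in>I. bd (c i))"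
  by (induction I rule: infinite_finite_induct) simp_all

lemma map_chain_sum: "map_chain f (\<Sum>i\<in>I. c i) = (\<Sum>i\<in>I. map_chain f (c i))"
  by (induction I rule: infinite_finite_induct) simp_all

lemma eval_chain_sum: "eval_chain f (\<Sum>i\<in>I. c i) = (\<Sum>i\<in>I. eval_chain f (c i))"
  by (induction I rule: infinite_finite_induct) simp_all

text \<open>Coning is a contracting homotopy; because the empty list is kept, degree zero is no
  exception.\<close>

lemma bd_cone [simp]: "bd (cone_chain x c) = c - cone_chain x (bd c)"
  using subset_UNIV by (induction c rule: frag_induction) simp_all

lemma bd_bd_list: "bd (bd_list L) = 0"
  by (induction L) simp_all

lemma bd_bd [simp]: "bd (bd c) = 0"
  using subset_UNIV by (induction c rule: frag_induction) (simp_all add: bd_bd_list)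

lemma map_chain_cone [simp]: "map_chain f (cone_chain x c) = cone_chain (f x) (map_chain f c)"
  using subset_UNIV by (induction c rule: frag_induction) simp_all

lemma bd_map_chain [simp]: "bd (map_chain f c) = map_chain f (bd c)"
proof -
  have "bd_list (map f L) = map_chain f (bd_list L)" for L
    by (induction L) simp_all
  with subset_UNIV show ?thesis by (induction c rule: frag_induction) simp_all
qed

lemma map_chain_compose: "map_chain f (map_chain g c) = map_chain (f \<circ> g) c"
  using subset_UNIV by (induction c rule: frag_induction) (simp_all add: comp_def)

lemma map_chain_cong:
  "Poly_Mapping.keys c \<subseteq> {L. set L \<subseteq> X} \<Longrightarrow> (\<And>x. x \<in> X \<Longrightarrow> f x = g x) \<Longrightarrow> map_chain f c = map_chain g c"
  unfolding map_chain_def by (rule frag_extend_eq) (fastforce intro: arg_cong[of _ _ frag_of])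

lemma map_chain_id [simp]: "map_chain id c = c"
  using subset_UNIV by (induction c rule: frag_induction) simp_all

lemma keys_map_chain: "Poly_Mapping.keys (map_chain f c) \<subseteq> map f ` Poly_Mapping.keys c"
  using keys_frag_extend[of "\<lambda>L. frag_of (map f L)" c] by (auto simp: map_chain_def)

lemma keys_cone_chain: "Poly_Mapping.keys (cone_chain x c) \<subseteq> (#) x ` Poly_Mapping.keys c"
  using keys_frag_extend[of "\<lambda>L. frag_of (x # L)" c] by (auto simp: cone_chain_def)

lemma keys_diff_subset:
  "Poly_Mapping.keys a \<subseteq> S \<Longrightarrow> Poly_Mapping.keys b \<subseteq> S \<Longrightarrow> Poly_Mapping.keys (a - b) \<subseteq> S" for a b :: "'a \<Rightarrow>\<^sub>0 int"
  using keys_diff[of a b] by blast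

lemma keys_sum_subset:
  "(\<And>i. i \<in> I \<Longrightarrow> Poly_Mapping.keys (a i) \<subseteq> S) \<Longrightarrow> Poly_Mapping.keys (\<Sum>i\<in>I. a i) \<subseteq> S" for a :: "'i \<Rightarrow> 'a \<Rightarrow>\<^sub>0 int"
  using keys_sum[of a I] by blast

subsection \<open>Prisms\<close>

text \<open>Unfolded, this is the usual alternating sum of the tuples
  \<open>[f x0, ..., f xi, g xi, ..., g xn]\<close>. Writing it with cones reduces the homotopy
  formula to \<open>bd_cone\<close>.\<close>

primrec prism_list :: "('a \<Rightarrow> 'b) \<Rightarrow> ('a \<Rightarrow> 'b) \<Rightarrow> 'a list \<Rightarrow> 'b chain" where
  "prism_list f g [] = 0"
| "prism_list f g (x # L) = cone_chain (f x) (frag_of (map g (x # L)) - prism_list f g L)"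

definition prism :: "('a \<Rightarrow> 'b) \<Rightarrow> ('a \<Rightarrow> 'b) \<Rightarrow> 'a chain \<Rightarrow> 'b chain"
  where "prism f g = frag_extend (prism_list f g)"

lemma prism_simps [simp]:
  "prism f g 0 = 0" "prism f g (frag_of L) = prism_list f g L"
  "prism f g (c - d) = prism f g c - prism f g d"
  by (simp_all add: prism_def frag_extend_diff)

lemma prism_cone_chain: "prism f g (cone_chain x c) = cone_chain (f x) (map_chain g (cone_chain x c) - prism f g c)"
  using subset_UNIV by (induction c rule: frag_induction) simp_all

lemma bd_prism: "bd (prism f g c) = map_chain g c - map_chain f c - prism f g (bd c)"
proof -
  have "bd (prism_list f g L) = map_chain g (frag_of L) - map_chain f (frag_of L) - prism f g (bd_list L)" for L
  proof (induction L)
    case (Cons x L)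
    have "map_chain g (bd_list L) = bd_list (map g L)"
      by (metis bd_map_chain bd_simps(2) map_chain_simps(2))
    with Cons show ?case
      by (simp add: prism_cone_chain)
  qed simp
  with subset_UNIV show ?thesis by (induction c rule: frag_induction) simp_all
qed

lemma keys_prism_list:
  "Poly_Mapping.keys (prism_list f g L) \<subseteq> {K. set K \<subseteq> f ` set L \<union> g ` set L \<and> length K = Suc (length L)}"
proof (induction L)
  case (Cons x L)
  have "Poly_Mapping.keys (frag_of (map g (x # L)) - prism_list f g L)
      \<subseteq> {K. set K \<subseteq> f ` set L \<union> g ` set (x # L) \<and> length K = Suc (length L)}"
    using Cons by (intro keys_diff_subset) auto
  then have "Poly_Mapping.keys (prism_list f g (x # L)) \<subseteq>
      (#) (f x) ` {K. set K \<subseteq> f ` set L \<union> g ` set (x # L) \<and> length K = Suc (length L)}"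
    using keys_cone_chain[of "f x" "frag_of (map g (x # L)) - prism_list f g L"]
    by (simp only: prism_list.simps) blast
  then show ?case by (rule subset_trans) auto
qed simp

subsection \<open>Cocycles of a cyclic group\<close>

text \<open>The carry in adding the residues of \<open>v - u\<close> and \<open>w - v\<close>. Its
  multiple by \<open>p\<close> is the coboundary of the integer cochain
  \<open>(v - u) mod p\<close>, so it represents the Bockstein of the degree-one class.\<close>

definition carry :: "int \<Rightarrow> int \<Rightarrow> int \<Rightarrow> int \<Rightarrow> int"
  where "carry p u v w = ((v - u) mod p + (w - v) mod p - (w - u) mod p) div p"

text \<open>The cup products of the degree-two class \<open>carry\<close> with itself and with the degree-one
  class \<open>[u, v] \<mapsto> v - u\<close>; \<open>cobase\<close> is a non-invariant cochain cobounding the odd ones modulo \<open>p\<close>.\<close>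

fun cocycle :: "int \<Rightarrow> int list \<Rightarrow> int" where
  "cocycle p [] = 0"
| "cocycle p [u] = 1"
| "cocycle p [u, v] = (v - u) mod p"
| "cocycle p (u # v # w # L) = carry p u v w * cocycle p (w # L)"

fun cobase :: "int \<Rightarrow> int list \<Rightarrow> int" where
  "cobase p [] = 0"
| "cobase p [u] = u"
| "cobase p [u, v] = 0"
| "cobase p (u # v # w # L) = carry p u v w * cobase p (w # L)"

lemma carry_eq: "p * carry p u v w = (v - u) mod p + (w - v) mod p - (w - u) mod p"
proof -
  have "(v - u) mod p + (w - v) mod p - (w - u) mod p =
      p * ((w - u) div p - (v - u) div p - (w - v) div p)"
    by (simp add: minus_mult_div_eq_mod[symmetric] right_diff_distrib)
  then show ?thesis
    unfolding carry_def by (simp only: dvd_mult_div_cancel dvd_triv_left)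
qed

text \<open>After multiplication by \<open>p\<close> this says that a coboundary has zero
  coboundary; \<open>p\<close> cancels, so the identity holds in the integers and not merely modulo
  \<open>p\<close>.\<close>

lemma carry_cocycle:
  assumes "p \<noteq> 0"
  shows "carry p v w y - carry p u w y + carry p u v y - carry p u v w = 0"
proof -
  have "p * (carry p v w y - carry p u w y + carry p u v y - carry p u v w) = 0"
    by (simp add: right_diff_distrib distrib_left carry_eq)
  with assms show ?thesis by simp
qed

text \<open>The Leibniz rule for the cup product with \<open>carry\<close>: its own coboundary
  vanishes, so the coboundary passes to the second factor. This drives the inductions that peel off
  two vertices at a time.\<close>

lemma eval_bd_list_carry:
  assumes p: "p \<noteq> 0"
    and rec: "\<And>u v w L. f (u # v # w # L) = carry p u v w * f (w # L)"
  shows "eval_chain f (bd_list (u # v # w # y # L)) = carry p u v w * eval_chain f (bd_list (w # y # L))"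
proof -
  have *: "eval_chain f (cone_chain u (cone_chain v (cone_chain w c))) = carry p u v w * eval_chain f (cone_chain w c)" for c
    using subset_UNIV by (induction c rule: frag_induction) (simp_all add: rec right_diff_distrib)
  have "eval_chain f (bd_list (u # v # w # y # L)) =
      (carry p v w y - carry p u w y + carry p u v y) * f (y # L)
        - carry p u v w * (f (w # L) - eval_chain f (cone_chain w (cone_chain y (bd_list L))))"
    using rec[of v w y L] rec[of u w y L] rec[of u v y L] rec[of u v w L]
    by (simp add: algebra_simps *)
  also have "carry p v w y - carry p u w y + carry p u v y = carry p u v w"
    using carry_cocycle[OF p, of v w y u] by simp
  finally show ?thesis by (simp add: algebra_simps)
qed

text \<open>The Bockstein relation: in the product on tuples of even length only the last factor, a
  residue, has a coboundary, and that is \<open>p\<close> times one more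
  \<open>carry\<close>.\<close>

lemma cocycle_bd_odd:
  assumes "p \<noteq> 0" "odd (length L)" "length L \<ge> 2"
  shows "eval_chain (cocycle p) (bd_list L) = p * cocycle p L"
  using assms
proof (induction p L rule: cocycle.induct)
  case (4 p u v w L)
  show ?case
  proof (cases L)
    case Nil
    then show ?thesis by (simp add: carry_eq)
  next
    case (Cons y K)
    with 4 show ?thesis using eval_bd_list_carry[OF 4(2), of "cocycle p" u v w y K]
      by (simp del: bd_list.simps)
  qed
qed auto

text \<open>Here the last factor is the vertex itself, and its coboundary \<open>v - u\<close>
  agrees with the residue modulo \<open>p\<close>.\<close>

lemma cobase_bd_even:
  assumes "p \<noteq> 0" "even (length L)"
  shows "p dvd eval_chain (cobase p) (bd_list L) - cocycle p L"
  using assms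
proof (induction p L rule: cocycle.induct)
  case (3 p u v)
  then show ?case by (simp flip: mod_eq_dvd_iff)
next
  case (4 p u v w L)
  then obtain y K where "L = y # K" by (cases L) auto
  with 4 show ?case using eval_bd_list_carry[OF 4(2), of "cobase p" u v w y K]
    by (simp del: bd_list.simps flip: right_diff_distrib)
qed auto

definition shift :: "int \<Rightarrow> int \<Rightarrow> int"
  where "shift p u = (u + 1) mod p"

lemma shift_diff: "(shift p v - shift p u) mod p = (v - u) mod p"
proof -
  have "(shift p v - shift p u) mod p = ((v + 1) - (u + 1)) mod p"
    unfolding shift_def by (rule mod_diff_eq)
  then show ?thesis by simp
qed

lemma carry_shift: "carry p (shift p u) (shift p v) (shift p w) = carry p u v w"
  by (simp add: carry_def shift_diff)

lemma cocycle_shift: "cocycle p (map (shift p) L) = cocycle p L"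
  by (induction p L rule: cocycle.induct) (simp_all add: shift_diff carry_shift)

text \<open>All \<open>carry\<close> factors are invariant and the last vertex grows by one modulo
  \<open>p\<close>; the defect of invariance is therefore the product of the carries, which is
  \<open>cocycle\<close> again.\<close>

lemma cobase_shift:
  "odd (length L) \<Longrightarrow> p dvd cobase p (map (shift p) L) - (cobase p L + cocycle p L)"
proof (induction p L rule: cocycle.induct)
  case (2 p u)
  then show ?case by (simp add: shift_def flip: mod_eq_dvd_iff)
next
  case (4 p u v w L)
  then have "p dvd carry p u v w * (cobase p (map (shift p) (w # L)) - (cobase p (w # L) + cocycle p (w # L)))"
    by simp
  then show ?case by (simp add: carry_shift algebra_simps)
qed auto

lemma eval_map_shift: "eval_chain (cocycle p) (map_chain (shift p) c) = eval_chain (cocycle p) c"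
  using subset_UNIV by (induction c rule: frag_induction) (simp_all add: cocycle_shift)

text \<open>Modulo \<open>p\<close>, the cocycle on \<open>d\<close> is \<open>cobase\<close> on
  \<open>bd d\<close>, that is on \<open>c\<close> minus its shift, and this difference is minus the
  cocycle on \<open>c\<close>. The sign is why the final invariant is only known up to sign.\<close>

lemma eval_cocycle_odd_step:
  assumes p: "p > 0" and n: "odd n"
    and c: "Poly_Mapping.keys c \<subseteq> {L. length L = n}"
    and d: "Poly_Mapping.keys d \<subseteq> {L. length L = Suc n}"
    and bd: "bd d = c - map_chain (shift p) c"
  shows "p dvd eval_chain (cocycle p) d + eval_chain (cocycle p) c"
proof -
  have "p dvd eval_chain (cobase p) (bd d) - eval_chain (cocycle p) d"
    using d
  proof (induction d rule: frag_induction)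
    case (one L)
    then show ?case using cobase_bd_even[of p L] p n by simp
  next
    case (diff a b)
    then show ?case
      using dvd_diff[OF diff] by (simp add: algebra_simps)
  qed simp
  moreover have "p dvd eval_chain (cobase p) (map_chain (shift p) c)
      - (eval_chain (cobase p) c + eval_chain (cocycle p) c)"
    using c
  proof (induction c rule: frag_induction)
    case (one L)
    then show ?case using cobase_shift[of L p] n by simp
  next
    case (diff a b)
    then show ?case
      using dvd_diff[OF diff] by (simp add: algebra_simps)
  qed simp
  ultimately have "p dvd (eval_chain (cobase p) (bd d) - eval_chain (cocycle p) d)
     + (eval_chain (cobase p) (map_chain (shift p) c) - (eval_chain (cobase p) c + eval_chain (cocycle p) c))"
    by (rule dvd_add)
  moreover have "\<dots> = - (eval_chain (cocycle p) d + eval_chain (cocycle p) c)"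
    by (simp add: bd)
  ultimately show ?thesis by (simp only: dvd_minus_iff)
qed

text \<open>On \<open>bd d\<close> the cocycle equals \<open>p\<close> times its value on
  \<open>d\<close> by the Bockstein relation, and \<open>p\<close> times its value on
  \<open>c\<close> by invariance. Cancelling \<open>p\<close> requires integer values; a computation
  modulo \<open>p\<close> would lose this step.\<close>

lemma eval_cocycle_even_step:
  assumes p: "p > 0" and n: "even n" "n > 0"
    and d: "Poly_Mapping.keys d \<subseteq> {L. length L = Suc n}"
    and bd: "bd d = (\<Sum>j<nat p. (map_chain (shift p) ^^ j) c)"
  shows "eval_chain (cocycle p) d = eval_chain (cocycle p) c"
proof -
  have "eval_chain (cocycle p) (bd d) = p * eval_chain (cocycle p) d"
    using d
  proof (induction d rule: frag_induction)
    case (one L)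
    then show ?case using cocycle_bd_odd[of p L] p n by simp
  qed (simp_all add: right_diff_distrib)
  moreover have "eval_chain (cocycle p) ((map_chain (shift p) ^^ j) c) = eval_chain (cocycle p) c" for j
    by (induction j) (simp_all add: eval_map_shift)
  then have "eval_chain (cocycle p) (bd d) = p * eval_chain (cocycle p) c"
    using p by (simp add: bd eval_chain_sum)
  ultimately show ?thesis using p by simp
qed

text \<open>The two alternating differentials of the periodic free resolution for a cyclic group of
  order \<open>p\<close>: \<open>1 - T\<close> and the norm.\<close>

definition cyclic_op :: "nat \<Rightarrow> nat \<Rightarrow> ('a \<Rightarrow> 'a) \<Rightarrow> 'a chain \<Rightarrow> 'a chain"
  where "cyclic_op p i T c =
    (if even i then c - map_chain T c else (\<Sum>j<p. (map_chain T ^^ j) c))"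

lemma cyclic_sequence_nonzero:
  assumes p: "p \<ge> 2"
    and keys: "\<And>i. i \<le> n \<Longrightarrow> Poly_Mapping.keys (e i) \<subseteq> {L. length L = Suc i}"
    and e0: "e 0 = frag_of [u]"
    and bd: "\<And>i. i < n \<Longrightarrow> bd (e (Suc i)) = cyclic_op p i (shift (int p)) (e i)"
  shows "e n \<noteq> 0"
proof -
  let ?A = "\<lambda>i. eval_chain (cocycle (int p)) (e i)"
  have "i \<le> n \<Longrightarrow> int p dvd ?A i - 1 \<or> int p dvd ?A i + 1" for i
  proof (induction i)
    case 0
    then show ?case by (simp add: e0)
  next
    case (Suc i)
    show ?case
    proof (cases "even i")
      case True
      \<comment> \<open>Tuples in \<open>e i\<close> have length \<open>i + 1\<close>, so an even
        \<open>i\<close> is a step starting from odd length.\<close>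
      then have "int p dvd ?A (Suc i) + ?A i"
        using p Suc.prems bd[of i] keys[of i] keys[of "Suc i"]
        by (intro eval_cocycle_odd_step[of _ "Suc i"]) (auto simp: cyclic_op_def)
      then have "int p dvd ?A i - 1 \<Longrightarrow> int p dvd ?A (Suc i) + 1"
        and "int p dvd ?A i + 1 \<Longrightarrow> int p dvd ?A (Suc i) - 1"
        using dvd_diff[of "int p" "?A (Suc i) + ?A i"] by fastforce+
      with Suc show ?thesis by auto
    next
      case False
      then have "?A (Suc i) = ?A i"
        using p Suc.prems bd[of i] keys[of "Suc i"]
        by (intro eval_cocycle_even_step[of _ "Suc i"]) (auto simp: cyclic_op_def)
      with Suc show ?thesis by simp
    qed
  qed
  from this[of n] p show ?thesis
    by auto
qed

subsection \<open>Sorting\<close>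

text \<open>Passing a smaller index costs a sign and meeting an equal one kills the tuple. Iterated
  insertion thus normalises ordered tuples to oriented ones with distinct indices.\<close>

primrec insert_label :: "nat \<times> 'b \<Rightarrow> (nat \<times> 'b) list \<Rightarrow> (nat \<times> 'b) chain" where
  "insert_label x [] = frag_of [x]"
| "insert_label x (y # L) = (if fst x < fst y then frag_of (x # y # L)
     else if fst x = fst y then 0 else - cone_chain y (insert_label x L))"

primrec sort_list :: "(nat \<times> 'b) list \<Rightarrow> (nat \<times> 'b) chain" where
  "sort_list [] = frag_of []"
| "sort_list (x # L) = frag_extend (insert_label x) (sort_list L)"

definition sort_chain :: "(nat \<times> 'b) chain \<Rightarrow> (nat \<times> 'b) chain"
  where "sort_chain = frag_extend sort_list"

lemma sort_chain_simps [simp]: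
  "sort_chain 0 = 0" "sort_chain (frag_of L) = sort_list L"
  "sort_chain (c - d) = sort_chain c - sort_chain d"
  "sort_chain (c + d) = sort_chain c + sort_chain d"
  by (simp_all add: sort_chain_def frag_extend_diff frag_extend_add)

lemma insert_label_cone:
  "frag_extend (insert_label x) (cone_chain y c) =
    (if fst x < fst y then cone_chain x (cone_chain y c)
     else if fst x = fst y then 0 else - cone_chain y (frag_extend (insert_label x) c))"
  using subset_UNIV by (induction c rule: frag_induction) (auto simp: frag_extend_diff)

abbreviation strictly_sorted :: "(nat \<times> 'b) list \<Rightarrow> bool"
  where "strictly_sorted \<equiv> sorted_wrt (\<lambda>x y. fst x < fst y)"

lemma insert_label_less: "\<forall>y\<in>set L. fst x < fst y \<Longrightarrow> insert_label x L = frag_of (x # L)"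
  by (cases L) auto

text \<open>If \<open>x\<close> meets a label \<open>y\<close> of the same index, the left side is
  zero, and on the right the faces omitting \<open>x\<close> and omitting \<open>y\<close> have to
  cancel. They do so only when the labels agree in the group element as well.\<close>

lemma bd_insert_label:
  assumes "strictly_sorted L" "\<And>y. y \<in> set L \<Longrightarrow> fst y = fst x \<Longrightarrow> y = x"
  shows "bd (insert_label x L) = frag_of L - frag_extend (insert_label x) (bd_list L)"
  using assms
proof (induction L)
  case (Cons y L)
  consider "fst x < fst y" | "fst x = fst y" | "fst x > fst y" by linarith
  then show ?case
  proof cases
    case 1
    then have "insert_label x L = frag_of (x # L)"
      using Cons.prems(1) by (intro insert_label_less) auto
    with 1 show ?thesis
      by (simp add: frag_extend_diff insert_label_cone)
  next
    case 2
    then have "y = x" using Cons.prems(2)[of y] by simp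
    moreover have "insert_label x L = frag_of (x # L)"
      using 2 Cons.prems(1) by (intro insert_label_less) auto
    ultimately show ?thesis
      by (simp add: frag_extend_diff insert_label_cone)
  next
    case 3
    with Cons show ?thesis
      by (simp add: frag_extend_diff insert_label_cone)
  qed
qed simp

lemma keys_insert_label:
  "strictly_sorted L \<Longrightarrow> Poly_Mapping.keys (insert_label x L) \<subseteq>
    {K. strictly_sorted K \<and> set K \<subseteq> insert x (set L) \<and> length K = Suc (length L)}"
proof (induction L)
  case (Cons y L)
  then have IH: "Poly_Mapping.keys (insert_label x L) \<subseteq>
      {K. strictly_sorted K \<and> set K \<subseteq> insert x (set L) \<and> length K = Suc (length L)}"
    by simp
  show ?case
  proof (cases "fst x > fst y")
    case True
    have "Poly_Mapping.keys (insert_label x (y # L)) \<subseteq> (#) y ` Poly_Mapping.keys (insert_label x L)"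
      using True keys_cone_chain[of y "insert_label x L"] by simp
    also have "\<dots> \<subseteq> (#) y ` {K. strictly_sorted K \<and> set K \<subseteq> insert x (set L) \<and> length K = Suc (length L)}"
      using IH by (rule image_mono)
    also have "\<dots> \<subseteq> {K. strictly_sorted K \<and> set K \<subseteq> insert x (set (y # L)) \<and> length K = Suc (length (y # L))}"
      using True Cons.prems by (fastforce dest: subsetD)
    finally show ?thesis .
  next
    case False
    with Cons.prems show ?thesis by (auto split: if_splits)
  qed
qed simp

lemma keys_sort_list:
  "Poly_Mapping.keys (sort_list L) \<subseteq> {K. strictly_sorted K \<and> set K \<subseteq> set L \<and> length K = length L}"
proof (induction L)
  case (Cons x L)
  have "Poly_Mapping.keys (sort_list (x # L)) \<subseteq> (\<Union>K\<in>Poly_Mapping.keys (sort_list L). Poly_Mapping.keys (insert_label x K))"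
    by (simp add: keys_frag_extend)
  also have "\<dots> \<subseteq> {K. strictly_sorted K \<and> set K \<subseteq> set (x # L) \<and> length K = length (x # L)}"
  proof (rule UN_least)
    fix K assume "K \<in> Poly_Mapping.keys (sort_list L)"
    with Cons have "strictly_sorted K" "set K \<subseteq> set L" "length K = length L" by auto
    with keys_insert_label[of K x]
    show "Poly_Mapping.keys (insert_label x K) \<subseteq> {K. strictly_sorted K \<and> set K \<subseteq> set (x # L) \<and> length K = length (x # L)}"
      by auto
  qed
  finally show ?case .
qed simp

lemma sort_chain_cone: "sort_chain (cone_chain x c) = frag_extend (insert_label x) (sort_chain c)"
  using subset_UNIV by (induction c rule: frag_induction) (simp_all add: frag_extend_diff)

lemma bd_sort_list:
  assumes "inj_on fst (set L)"
  shows "bd (sort_list L) = sort_chain (bd_list L)"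
  using assms
proof (induction L)
  case (Cons x L)
  have "bd (frag_extend (insert_label x) c) = c - frag_extend (insert_label x) (bd c)"
    if "Poly_Mapping.keys c \<subseteq> {K. strictly_sorted K \<and> set K \<subseteq> set L}" for c
    using that
  proof (induction c rule: frag_induction)
    case (one K)
    then show ?case
      using bd_insert_label[of K x] Cons.prems by (auto simp: inj_on_def)
  qed (simp_all add: frag_extend_diff)
  from this[of "sort_list L"] show ?case
    using keys_sort_list[of L] Cons by (auto simp: sort_chain_cone)
qed simp

lemma bd_sort_chain:
  assumes "Poly_Mapping.keys c \<subseteq> {L. inj_on fst (set L)}"
  shows "bd (sort_chain c) = sort_chain (bd c)"
  using assms by (induction c rule: frag_induction) (simp_all add: bd_sort_list)

lemma keys_sort_chain:
  assumes "Poly_Mapping.keys c \<subseteq> {L. length L = n}"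
  shows "Poly_Mapping.keys (sort_chain c) \<subseteq> {L. length L = n}"
proof -
  have "Poly_Mapping.keys (sort_chain c) \<subseteq> (\<Union>K\<in>Poly_Mapping.keys c. Poly_Mapping.keys (sort_list K))"
    by (simp add: sort_chain_def keys_frag_extend)
  also have "\<dots> \<subseteq> {L. length L = n}"
    using keys_sort_list assms by (intro UN_least) auto
  finally show ?thesis .
qed

text \<open>Pigeonhole: a surviving sorted tuple would have \<open>n + 1\<close> distinct indices
  below \<open>n\<close>.\<close>

lemma sort_chain_eq_0:
  assumes "Poly_Mapping.keys c \<subseteq> {L. fst ` set L \<subseteq> {..<n} \<and> length L = Suc n}"
  shows "sort_chain c = 0"
  using assms
proof (induction c rule: frag_induction)
  case (one L)
  have False if K: "K \<in> Poly_Mapping.keys (sort_list L)" for K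
  proof -
    have "strictly_sorted K" "set K \<subseteq> set L" "length K = length L"
      using keys_sort_list[of L] K by auto
    then have "distinct (map fst K)" "set (map fst K) \<subseteq> {..<n}" "length (map fst K) = Suc n"
      using one strict_sorted_iff[of "map fst K"] by (auto simp: sorted_wrt_map)
    then show False
      using card_mono[of "{..<n}" "set (map fst K)"] distinct_card[of "map fst K"] by simp
  qed
  then have "Poly_Mapping.keys (sort_list L) = {}" by blast
  then show ?case by simp
qed simp_all

text \<open>Sorting inspects only the indices, so it commutes with any change of the second
  components; this carries equivariance through the sorting.\<close>

lemma sort_chain_map:
  assumes "\<And>x. fst (t x) = fst x"
  shows "sort_chain (map_chain t c) = map_chain t (sort_chain c)"
proof -
  have ins: "insert_label (t x) (map t L) = map_chain t (insert_label x L)" for x L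
    by (induction L) (simp_all add: assms)
  have "frag_extend (insert_label (t x)) (map_chain t c) = map_chain t (frag_extend (insert_label x) c)" for x c
    using subset_UNIV by (induction c rule: frag_induction) (simp_all add: ins frag_extend_diff)
  then have "sort_list (map t L) = map_chain t (sort_list L)" for L
    by (induction L) simp_all
  with subset_UNIV show ?thesis by (induction c rule: frag_induction) simp_all
qed

subsection \<open>Fine chains\<close>

definition fine_lists :: "'a::metric_space set \<Rightarrow> real \<Rightarrow> nat \<Rightarrow> 'a list set"
  where "fine_lists X e n = {L. length L = n \<and> set L \<subseteq> X \<and> (\<forall>x\<in>set L. \<forall>y\<in>set L. dist x y < e)}"

lemma fine_lists_mono: "X \<subseteq> Y \<Longrightarrow> d \<le> e \<Longrightarrow> fine_lists X d n \<subseteq> fine_lists Y e n"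
proof
  fix L assume "X \<subseteq> Y" "d \<le> e" "L \<in> fine_lists X d n"
  moreover from this have "\<forall>x\<in>set L. \<forall>y\<in>set L. dist x y < e"
    by (metis (mono_tags, lifting) fine_lists_def mem_Collect_eq order_less_le_trans)
  ultimately show "L \<in> fine_lists Y e n"
    by (auto simp: fine_lists_def)
qed

text \<open>The contraction is cut into \<open>K\<close> time steps so short that, by uniform
  continuity, nearby points at consecutive times have images within \<open>e\<close>. The modulus
  \<open>r\<close> is shared equally: half for the time step, half for the mesh of the
  cycle.\<close>

lemma fine_cycle_bounds:
  assumes X: "compact X" and cont: "continuous_on ({0..1::real} \<times> X) H"
    and HY: "H ` ({0..1::real} \<times> X) \<subseteq> Y"
    and H0: "\<And>x. x \<in> X \<Longrightarrow> H (0, x) = x" and H1: "\<And>x. x \<in> X \<Longrightarrow> H (1, x) = y"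
    and y: "y \<in> Y" and e: "e > 0"
  obtains d where "d > 0" "d \<le> e"
    "\<And>n c. Poly_Mapping.keys c \<subseteq> fine_lists X d n \<Longrightarrow> bd c = 0 \<Longrightarrow>
      \<exists>w. Poly_Mapping.keys w \<subseteq> fine_lists Y e (Suc n) \<and> bd w = c"
proof -
  have "uniformly_continuous_on ({0..1::real} \<times> X) H"
    using X cont by (intro compact_uniformly_continuous compact_Times) auto
  then obtain r where r: "r > 0"
    "\<And>z z'. z \<in> {0..1::real} \<times> X \<Longrightarrow> z' \<in> {0..1::real} \<times> X \<Longrightarrow> dist z z' < r \<Longrightarrow> dist (H z) (H z') < e"
    using e unfolding uniformly_continuous_on_def by metis
  obtain K :: nat where K: "K > 0" "1 / real K < r / 2"
    using r(1) by (metis half_gt_zero inverse_eq_divide reals_Archimedean zero_less_Suc)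
  have Hclose: "dist (H (s, x)) (H (t, x')) < e"
    if "s \<in> {0..1}" "t \<in> {0..1}" "x \<in> X" "x' \<in> X" "dist s t \<le> 1 / real K" "dist x x' < r / 2" for s t x x'
  proof (rule r(2))
    have "dist (s, x) (t, x') \<le> dist s t + dist x x'"
      by (simp add: dist_Pair_Pair sqrt_sum_squares_le_sum)
    with that K(2) show "dist (s, x) (t, x') < r" by linarith
  qed (use that in auto)
  define f where "f = (\<lambda>j x. H (real j / real K, x))"
  show thesis
  proof (rule that[of "min e (r / 2)"])
    fix n c assume keys: "Poly_Mapping.keys c \<subseteq> fine_lists X (min e (r / 2)) n" and bd: "bd c = 0"
    have closed: "map_chain (f 0) c = c" "map_chain (f K) c = map_chain (\<lambda>x. y) c"
      using map_chain_cong[of c X "f 0" id] map_chain_cong[of c X "f K" "\<lambda>x. y"] K keys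
      by (auto simp: f_def H0 H1 fine_lists_def subset_iff)
    \<comment> \<open>Placing the later time first makes each prism contribute \<open>f j\<close>
      minus \<open>f (Suc j)\<close>, so the boundaries telescope to \<open>c\<close> minus a cycle
      concentrated at \<open>y\<close>, which the cone fills.\<close>
    define w where "w = (\<Sum>j<K. prism (f (Suc j)) (f j) c) + cone_chain y (map_chain (f K) c)"
    have "bd w = (\<Sum>j<K. map_chain (f j) c - map_chain (f (Suc j)) c) + map_chain (f K) c"
      by (simp add: w_def bd_sum bd_prism bd)
    also have "\<dots> = c"
      by (simp only: sum_lessThan_telescope'[of "\<lambda>j. map_chain (f j) c"] closed diff_add_cancel)
    finally have "bd w = c" .
    moreover have "Poly_Mapping.keys w \<subseteq> fine_lists Y e (Suc n)"
    proof -
      have "Poly_Mapping.keys (prism (f (Suc j)) (f j) c) \<subseteq> fine_lists Y e (Suc n)" if j: "j < K" for j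
      proof -
        have "Poly_Mapping.keys (prism_list (f (Suc j)) (f j) L) \<subseteq> fine_lists Y e (Suc n)"
          if L: "L \<in> Poly_Mapping.keys c" for L
        proof
          fix M assume "M \<in> Poly_Mapping.keys (prism_list (f (Suc j)) (f j) L)"
          then have M: "set M \<subseteq> f (Suc j) ` set L \<union> f j ` set L" "length M = Suc (length L)"
            using keys_prism_list by blast+
          from L keys have L': "length L = n" "set L \<subseteq> X" "\<And>x x'. x \<in> set L \<Longrightarrow> x' \<in> set L \<Longrightarrow> dist x x' < r / 2"
            by (auto simp: fine_lists_def)
          have rng: "real i / real K \<in> {0..1}" if "i = j \<or> i = Suc j" for i
            using that j by auto
          have cl: "dist (real i / real K) (real i' / real K) \<le> 1 / real K"
            if "i = j \<or> i = Suc j" "i' = j \<or> i' = Suc j" for i i'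
            using that K by (auto simp: dist_real_def field_simps abs_if)
          have cls: "dist (f i x) (f i' x') < e" if "i = j \<or> i = Suc j" "i' = j \<or> i' = Suc j"
            "x \<in> set L" "x' \<in> set L" for i i' x x'
            unfolding f_def using that L' rng cl by (intro Hclose) auto
          have inY: "f i x \<in> Y" if "i = j \<or> i = Suc j" "x \<in> set L" for i x
            unfolding f_def using HY rng[OF that(1)] that(2) L'(2) by blast
          have "\<exists>i x. (i = j \<or> i = Suc j) \<and> x \<in> set L \<and> z = f i x" if "z \<in> set M" for z
            using M(1) that by blast
          with cls inY M(2) L'(1) show "M \<in> fine_lists Y e (Suc n)"
            unfolding fine_lists_def by simp (metis subsetI)
        qed
        then show ?thesis
          using keys_frag_extend[of "prism_list (f (Suc j)) (f j)" c] unfolding prism_def by blast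
      qed
      moreover have "Poly_Mapping.keys (cone_chain y (map_chain (f K) c)) \<subseteq> fine_lists Y e (Suc n)"
        using keys_cone_chain[of y "map_chain (f K) c"] keys_map_chain[of "\<lambda>x. y" c] keys y e
        unfolding closed fine_lists_def by fastforce
      ultimately show ?thesis
        unfolding w_def
        by (meson keys_add keys_sum_subset le_supI lessThan_iff order_trans)
    qed
    ultimately show "\<exists>w. Poly_Mapping.keys w \<subseteq> fine_lists Y e (Suc n) \<and> bd w = c" by blast
  qed (use e r in auto)
qed

lemma funpow_map_chain: "(map_chain (T :: 'a \<Rightarrow> 'a) ^^ j) c = map_chain (T ^^ j) c"
  by (induction j) (simp_all add: map_chain_compose comp_def map_chain_id[unfolded id_def])

lemma bd_cyclic_op: "bd (cyclic_op p i T c) = cyclic_op p i T (bd c)"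
  by (simp add: cyclic_op_def bd_sum funpow_map_chain)

text \<open>Both composites of \<open>1 - T\<close> with the norm telescope to
  \<open>1 - T ^^ p\<close>.\<close>

lemma cyclic_op_Suc:
  assumes "T ^^ p = id"
  shows "cyclic_op p (Suc i) T (cyclic_op p i T c) = 0"
proof -
  have comm: "T \<circ> T ^^ j = T ^^ j \<circ> T" for j
    by (simp add: funpow_Suc_right flip: funpow.simps(2))
  have "(\<Sum>j<p. map_chain (T ^^ j) c - map_chain (T ^^ Suc j) c) = 0"
    by (subst sum_lessThan_telescope') (simp only: assms funpow_0 id_def[symmetric] funpow.simps(1) diff_self)
  then have "(\<Sum>j<p. map_chain (T ^^ j \<circ> T) c) = (\<Sum>j<p. map_chain (T ^^ j) c)"
    by (simp add: sum_subtractf comm)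
  then show ?thesis
    by (simp add: cyclic_op_def funpow_map_chain map_chain_sum map_chain_compose sum_subtractf comm)
qed

lemma keys_map_isometry:
  assumes T: "T ` X \<subseteq> X" and isom: "\<And>x y. dist (T x) (T y) = dist x y"
    and c: "Poly_Mapping.keys c \<subseteq> fine_lists X e n"
  shows "Poly_Mapping.keys ((map_chain T ^^ j) c) \<subseteq> fine_lists X e n"
proof (induction j)
  case (Suc j)
  have "map T ` fine_lists X e n \<subseteq> fine_lists X e n"
    using T by (fastforce simp: fine_lists_def isom)
  with Suc keys_map_chain[of T "(map_chain T ^^ j) c"] show ?case
    by (simp only: funpow.simps comp_apply) blast
qed (simp add: c)

lemma keys_cyclic_op:
  assumes "T ` X \<subseteq> X" "\<And>x y. dist (T x) (T y) = dist x y"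
    and "Poly_Mapping.keys c \<subseteq> fine_lists X e n"
  shows "Poly_Mapping.keys (cyclic_op p i T c) \<subseteq> fine_lists X e n"
  using assms(3) keys_map_isometry[OF assms] keys_map_isometry[OF assms, of 1]
  by (simp add: cyclic_op_def keys_diff_subset keys_sum_subset)

text \<open>The mesh is determined backwards: filling with mesh \<open>e\<close> in the next set
  asks for a smaller mesh of everything before. Hence the induction carries the quantifier over all
  \<open>e\<close>.\<close>

lemma fine_cyclic_sequence:
  fixes X :: "nat \<Rightarrow> 'a::metric_space set"
  assumes X: "\<And>i. i < n \<Longrightarrow> compact (X i)" and x0: "x0 \<in> X 0"
    and T: "\<And>i. i < n \<Longrightarrow> T ` X i \<subseteq> X i" and isom: "\<And>x y. dist (T x) (T y) = dist x y"
    and Tp: "T ^^ p = id"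
    and H: "\<And>i. i < n \<Longrightarrow> \<exists>H y. continuous_on ({0..1::real} \<times> X i) H \<and> H ` ({0..1::real} \<times> X i) \<subseteq> X (Suc i) \<and>
      (\<forall>x\<in>X i. H (0, x) = x \<and> H (1, x) = y) \<and> y \<in> X (Suc i)"
    and e: "e > 0"
  shows "\<exists>c. c 0 = frag_of [x0] \<and>
    (\<forall>i\<le>n. Poly_Mapping.keys (c i) \<subseteq> fine_lists (X i) e (Suc i)) \<and>
    (\<forall>i<n. bd (c (Suc i)) = cyclic_op p i T (c i))"
proof -
  have "k \<le> n \<Longrightarrow> \<forall>e>0. \<exists>c. c 0 = frag_of [x0] \<and>
    (\<forall>i\<le>k. Poly_Mapping.keys (c i) \<subseteq> fine_lists (X i) e (Suc i)) \<and>
    (\<forall>i<k. bd (c (Suc i)) = cyclic_op p i T (c i))" for k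
  proof (induction k)
    case 0
    then show ?case
      using x0 by (auto simp: fine_lists_def intro!: exI[of _ "\<lambda>_. frag_of [x0]"])
  next
    case (Suc k)
    show ?case
    proof (intro allI impI)
      fix e :: real assume e: "e > 0"
      have "k < n" using Suc.prems by simp
      from H[OF this] obtain h y where h: "continuous_on ({0..1::real} \<times> X k) h" "h ` ({0..1::real} \<times> X k) \<subseteq> X (Suc k)"
        "\<And>x. x \<in> X k \<Longrightarrow> h (0, x) = x" "\<And>x. x \<in> X k \<Longrightarrow> h (1, x) = y" "y \<in> X (Suc k)"
        by blast
      obtain d where d: "d > 0" "d \<le> e"
        "\<And>n c. Poly_Mapping.keys c \<subseteq> fine_lists (X k) d n \<Longrightarrow> bd c = 0 \<Longrightarrow>
          \<exists>w. Poly_Mapping.keys w \<subseteq> fine_lists (X (Suc k)) e (Suc n) \<and> bd w = c"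
        using fine_cycle_bounds[OF X[OF \<open>k < n\<close>] h e] by blast
      obtain c where c0: "c 0 = frag_of [x0]"
        and ck: "\<And>i. i \<le> k \<Longrightarrow> Poly_Mapping.keys (c i) \<subseteq> fine_lists (X i) d (Suc i)"
        and cb: "\<And>i. i < k \<Longrightarrow> bd (c (Suc i)) = cyclic_op p i T (c i)"
        using Suc d(1) by (meson Suc_leD)
      \<comment> \<open>In degree zero the augmentations of \<open>[x0]\<close> and
        \<open>[T x0]\<close> cancel; later on, consecutive operators compose to zero.\<close>
      have "bd (cyclic_op p k T (c k)) = 0"
      proof (cases k)
        case 0
        then show ?thesis by (simp add: bd_cyclic_op c0 cyclic_op_def)
      next
        case (Suc j)
        then show ?thesis using cb[of j] by (simp add: bd_cyclic_op cyclic_op_Suc[OF Tp])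
      qed
      moreover have "Poly_Mapping.keys (cyclic_op p k T (c k)) \<subseteq> fine_lists (X k) d (Suc k)"
        using ck[of k] T[OF \<open>k < n\<close>] isom by (intro keys_cyclic_op) auto
      ultimately obtain w where w: "Poly_Mapping.keys w \<subseteq> fine_lists (X (Suc k)) e (Suc (Suc k))"
        "bd w = cyclic_op p k T (c k)"
        using d(3) by blast
      have "Poly_Mapping.keys (c i) \<subseteq> fine_lists (X i) e (Suc i)" if "i \<le> k" for i
        using ck[OF that] fine_lists_mono[OF subset_refl d(2)] by blast
      with w c0 cb show "\<exists>c. c 0 = frag_of [x0] \<and>
        (\<forall>i\<le>Suc k. Poly_Mapping.keys (c i) \<subseteq> fine_lists (X i) e (Suc i)) \<and>
        (\<forall>i<Suc k. bd (c (Suc i)) = cyclic_op p i T (c i))"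
        by (intro exI[of _ "c(Suc k := w)"]) (auto simp: le_Suc_eq less_Suc_eq)
    qed
  qed
  from this[of n] e show ?thesis by simp
qed

section \<open>A zero theorem for filtered spaces with a cyclic symmetry\<close>

lemma uniform_separation:
  fixes A B :: "'i \<Rightarrow> 'a::heine_borel set"
  assumes "finite S" and "\<And>s. s \<in> S \<Longrightarrow> compact (A s) \<and> compact (B s) \<and> A s \<inter> B s = {}"
  shows "\<exists>d>0. \<forall>s\<in>S. \<forall>x\<in>A s. \<forall>y\<in>B s. d \<le> dist x y"
proof -
  have "\<exists>d>0. \<forall>x\<in>A s. \<forall>y\<in>B s. d \<le> dist x y" if "s \<in> S" for s
    using assms(2)[OF that] separate_compact_closed[of "A s" "B s"] compact_imp_closed by blast
  then obtain d where d: "\<And>s. s \<in> S \<Longrightarrow> d s > 0 \<and> (\<forall>x\<in>A s. \<forall>y\<in>B s. d s \<le> dist x y)"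
    by metis
  show ?thesis
  proof (intro exI[of _ "Min (insert 1 (d ` S))"] conjI ballI)
    show "Min (insert 1 (d ` S)) > 0"
      using assms(1) d by simp
    fix s x y assume s: "s \<in> S" and xy: "x \<in> A s" "y \<in> B s"
    have "Min (insert 1 (d ` S)) \<le> d s"
      using assms(1) s by (intro Min_le) auto
    also have "d s \<le> dist x y"
      using d[OF s] xy by blast
    finally show "Min (insert 1 (d ` S)) \<le> dist x y" .
  qed
qed

text \<open>\<open>cyclic_op\<close> is applied only to \<open>c i\<close> with
  \<open>i < n\<close>, inside the sets where \<open>F\<close> is equivariant; \<open>X n\<close>
  just has room for the last filling. The target enters solely through the closed sets
  \<open>D i g\<close>, which for fixed \<open>i\<close> meet at most in \<open>0\<close>.\<close>

theorem cyclic_equivariant_zero: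
  fixes X :: "nat \<Rightarrow> 'a::heine_borel set" and F :: "'a \<Rightarrow> 'b::{topological_space, zero}"
  assumes X: "\<And>i. i \<le> n \<Longrightarrow> compact (X i)" and Xn: "\<And>i. i < n \<Longrightarrow> X i \<subseteq> X n" and x0: "x0 \<in> X 0"
    and T: "\<And>i. i < n \<Longrightarrow> T ` X i \<subseteq> X i" and isom: "\<And>x y. dist (T x) (T y) = dist x y"
    and p: "p \<ge> 2" and Tp: "T ^^ p = id"
    and H: "\<And>i. i < n \<Longrightarrow> \<exists>H y. continuous_on ({0..1::real} \<times> X i) H \<and> H ` ({0..1::real} \<times> X i) \<subseteq> X (Suc i) \<and>
      (\<forall>x\<in>X i. H (0, x) = x \<and> H (1, x) = y) \<and> y \<in> X (Suc i)"
    and F: "continuous_on (X n) F"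
    and D: "\<And>i g. i < n \<Longrightarrow> g < p \<Longrightarrow> closed (D i g)"
    and cover: "\<And>y. y \<noteq> 0 \<Longrightarrow> \<exists>i<n. \<exists>g<p. y \<in> D i g"
    and disj: "\<And>y i g g'. i < n \<Longrightarrow> g < p \<Longrightarrow> g' < p \<Longrightarrow> y \<in> D i g \<Longrightarrow> y \<in> D i g' \<Longrightarrow> y \<noteq> 0 \<Longrightarrow> g = g'"
    and equiv: "\<And>x i j g. j < n \<Longrightarrow> x \<in> X j \<Longrightarrow> i < n \<Longrightarrow> g < p \<Longrightarrow> F x \<in> D i g \<Longrightarrow> F (T x) \<in> D i (Suc g mod p)"
  shows "\<exists>x\<in>X n. F x = 0"
proof (rule ccontr)
  assume "\<not> (\<exists>x\<in>X n. F x = 0)"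
  then have nz: "F x \<noteq> 0" if "x \<in> X n" for x
    using that by blast
  define idx where "idx = (\<lambda>x. LEAST i. i < n \<and> (\<exists>g<p. F x \<in> D i g))"
  define grp where "grp = (\<lambda>x. THE g. g < p \<and> F x \<in> D (idx x) g)"
  define lab where "lab = (\<lambda>x. (idx x, int (grp x)))"
  have idx: "idx x < n \<and> (\<exists>g<p. F x \<in> D (idx x) g)" if "x \<in> X n" for x
    unfolding idx_def by (rule LeastI_ex) (use cover[OF nz[OF that]] in blast)
  have grp_eq: "grp x = g" if "x \<in> X n" "g < p" "F x \<in> D (idx x) g" for x g
    unfolding grp_def using that idx[OF that(1)] disj nz by (intro the_equality) auto
  have grp: "grp x < p \<and> F x \<in> D (idx x) (grp x)" if "x \<in> X n" for x
    using idx[OF that] grp_eq[OF that] by blast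
  have TX: "T x \<in> X j" if "j < n" "x \<in> X j" for x j
    using T that by blast
  \<comment> \<open>\<open>equiv\<close> only carries membership from \<open>x\<close> to
    \<open>T x\<close>. The converse follows by applying \<open>T\<close> another
    \<open>p - 1\<close> times, which returns to \<open>x\<close>.\<close>
  have idx_T: "idx (T x) = idx x" if j: "j < n" and x: "x \<in> X j" for x j
  proof -
    have fwd: "\<exists>g<p. F (T x) \<in> D i g" if "x \<in> X j" "i < n" "\<exists>g<p. F x \<in> D i g" for i x
      using equiv[OF j that(1,2)] that(3) p by (meson mod_less_divisor less_le_trans zero_less_numeral)
    have "\<exists>g<p. F ((T ^^ k) (T x)) \<in> D i g \<and> (T ^^ k) (T x) \<in> X j"
      if "i < n" "\<exists>g<p. F (T x) \<in> D i g" for i k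
      using that(2)
    proof (induction k)
      case 0
      then show ?case using TX[OF j x] by auto
    next
      case (Suc k)
      then show ?case using fwd[OF _ that(1), of "(T ^^ k) (T x)"] TX[OF j] by fastforce
    qed
    moreover have "(T ^^ (p - 1)) (T x) = x"
      using Tp p by (metis Suc_diff_1 comp_apply funpow_Suc_right id_apply less_le_trans zero_less_numeral)
    ultimately have "i < n \<and> (\<exists>g<p. F (T x) \<in> D i g) \<longleftrightarrow> i < n \<and> (\<exists>g<p. F x \<in> D i g)" for i
      using fwd[OF x] by metis
    then show ?thesis unfolding idx_def by presburger
  qed
  have lab_T: "lab (T x) = apsnd (shift (int p)) (lab x)" if j: "j < n" and x: "x \<in> X j" for x j
  proof -
    have xn: "x \<in> X n" "T x \<in> X n" using TX[OF j x] Xn[OF j] x by auto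
    have "grp (T x) = Suc (grp x) mod p"
      using grp[OF xn(1)] idx[OF xn(1)] equiv[OF j x] p idx_T[OF j x]
      by (intro grp_eq[OF xn(2)]) auto
    then show ?thesis
      by (simp add: lab_def idx_T[OF j x] shift_def zmod_int add.commute)
  qed
  define K where "K = (\<lambda>i g. X n \<inter> F -` D i g)"
  have K: "compact (K i g)" if "i < n" "g < p" for i g
  proof -
    have "closedin (top_of_set (X n)) (K i g)"
      unfolding K_def using F D[OF that] by (rule continuous_closedin_preimage)
    then show ?thesis using X closedin_compact by blast
  qed
  \<comment> \<open>For one index the preimages of different group elements are disjoint compact
    sets. These finitely many pairs have a common positive gap, and that gap becomes the mesh of the
    chains.\<close>
  define S where "S = {(i, g, g'). i < n \<and> g < p \<and> g' < p \<and> g \<noteq> g'}"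
  have "S \<subseteq> {..<n} \<times> {..<p} \<times> {..<p}" by (auto simp: S_def)
  then have "finite S" by (rule finite_subset) simp
  moreover have "compact (K (fst s) (fst (snd s))) \<and> compact (K (fst s) (snd (snd s))) \<and>
     K (fst s) (fst (snd s)) \<inter> K (fst s) (snd (snd s)) = {}" if "s \<in> S" for s
  proof -
    obtain i g g' where s: "s = (i, g, g')" by (cases s)
    with that have "i < n" "g < p" "g' < p" "g \<noteq> g'" by (auto simp: S_def)
    then have "K i g \<inter> K i g' = {}"
      unfolding K_def using disj nz by blast
    then show ?thesis using \<open>i < n\<close> \<open>g < p\<close> \<open>g' < p\<close> K s by simp
  qed
  ultimately have "\<exists>d>0. \<forall>s\<in>S. \<forall>x\<in>K (fst s) (fst (snd s)). \<forall>y\<in>K (fst s) (snd (snd s)). d \<le> dist x y"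
    by (rule uniform_separation)
  then obtain d where d: "d > 0"
    "\<And>s x y. s \<in> S \<Longrightarrow> x \<in> K (fst s) (fst (snd s)) \<Longrightarrow> y \<in> K (fst s) (snd (snd s)) \<Longrightarrow> d \<le> dist x y"
    by blast
  have close: "lab x = lab y" if "x \<in> X n" "y \<in> X n" "dist x y < d" "fst (lab x) = fst (lab y)" for x y
  proof (rule ccontr)
    assume "lab x \<noteq> lab y"
    with that(4) have i: "idx y = idx x" and g: "grp x \<noteq> grp y" by (auto simp: lab_def)
    have "(idx x, grp x, grp y) \<in> S"
      using grp that(1,2) idx g by (auto simp: S_def)
    moreover have "x \<in> K (idx x) (grp x)" "y \<in> K (idx x) (grp y)"
      using grp[OF that(1)] grp[OF that(2)] that(1,2) i by (auto simp: K_def)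
    ultimately have "d \<le> dist x y" using d(2) by fastforce
    with that(3) show False by simp
  qed
  have "\<exists>c. c 0 = frag_of [x0] \<and>
    (\<forall>i\<le>n. Poly_Mapping.keys (c i) \<subseteq> fine_lists (X i) d (Suc i)) \<and>
    (\<forall>i<n. bd (c (Suc i)) = cyclic_op p i T (c i))"
    using X by (intro fine_cyclic_sequence x0 T isom Tp H d(1)) simp
  then obtain c where c0: "c 0 = frag_of [x0]"
    and ck: "\<And>i. i \<le> n \<Longrightarrow> Poly_Mapping.keys (c i) \<subseteq> fine_lists (X i) d (Suc i)"
    and cb: "\<And>i. i < n \<Longrightarrow> bd (c (Suc i)) = cyclic_op p i T (c i)"
    by blast
  have sub: "X i \<subseteq> X n" if "i \<le> n" for i
    using Xn that by (cases "i = n") auto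
  have ck': "Poly_Mapping.keys (map_chain lab (c i)) \<subseteq>
      {L. length L = Suc i \<and> inj_on fst (set L) \<and> fst ` set L \<subseteq> {..<n}}" if i: "i \<le> n" for i
  proof
    fix M assume "M \<in> Poly_Mapping.keys (map_chain lab (c i))"
    then obtain L where M: "M = map lab L" and "L \<in> Poly_Mapping.keys (c i)"
      using keys_map_chain by blast
    then have L: "length L = Suc i" "set L \<subseteq> X n" "\<And>x y. x \<in> set L \<Longrightarrow> y \<in> set L \<Longrightarrow> dist x y < d"
      using ck[OF i] sub[OF i] by (fastforce simp: fine_lists_def)+
    have "inj_on fst (lab ` set L)"
    proof (rule inj_onI)
      fix a b assume ab: "a \<in> lab ` set L" "b \<in> lab ` set L" "fst a = fst b"
      then obtain x y where xy: "x \<in> set L" "y \<in> set L" "a = lab x" "b = lab y" by blast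
      then have "x \<in> X n" "y \<in> X n" using L(2) by blast+
      from close[OF this L(3)[OF xy(1,2)]] ab(3) xy(3,4) show "a = b" by simp
    qed
    moreover have "fst (lab x) < n" if "x \<in> set L" for x
      using idx L(2) that by (auto simp: lab_def)
    ultimately show "M \<in> {L. length L = Suc i \<and> inj_on fst (set L) \<and> fst ` set L \<subseteq> {..<n}}"
      using L(1) by (auto simp: M)
  qed
  \<comment> \<open>The indices have done their work once the tuples are sorted, so only the group
    elements are kept. Lengths are unchanged, as the cocycles require.\<close>
  define e where "e = (\<lambda>i. map_chain snd (sort_chain (map_chain lab (c i))))"
  have "e n \<noteq> 0"
  proof (rule cyclic_sequence_nonzero[OF p])
    fix i assume i: "i \<le> n"
    then have "Poly_Mapping.keys (sort_chain (map_chain lab (c i))) \<subseteq> {L. length L = Suc i}"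
      using ck' by (intro keys_sort_chain) fast
    then show "Poly_Mapping.keys (e i) \<subseteq> {L. length L = Suc i}"
      unfolding e_def using keys_map_chain[of snd "sort_chain (map_chain lab (c i))"] by fastforce
  next
    show "e 0 = frag_of [int (grp x0)]"
      by (simp add: e_def c0 lab_def)
  next
    fix i assume i: "i < n"
    have lin: "map_chain snd (sort_chain (map_chain lab (map_chain T u)))
        = map_chain (shift (int p)) (map_chain snd (sort_chain (map_chain lab u)))"
      if "Poly_Mapping.keys u \<subseteq> fine_lists (X i) d (Suc i)" for u
    proof -
      have "map_chain lab (map_chain T u) = map_chain (apsnd (shift (int p)) \<circ> lab) u"
        unfolding map_chain_compose using that lab_T[OF i]
        by (intro map_chain_cong[of u "X i"]) (auto simp: fine_lists_def)
      also have "\<dots> = map_chain (apsnd (shift (int p))) (map_chain lab u)"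
        by (simp add: map_chain_compose)
      finally have "sort_chain (map_chain lab (map_chain T u)) = map_chain (apsnd (shift (int p))) (sort_chain (map_chain lab u))"
        by (simp only: sort_chain_map fst_apsnd)
      moreover have "snd \<circ> apsnd (shift (int p)) = shift (int p) \<circ> (snd :: nat \<times> int \<Rightarrow> int)"
        by auto
      ultimately show ?thesis
        by (simp add: sort_chain_map map_chain_compose)
    qed
    have keysT: "Poly_Mapping.keys ((map_chain T ^^ j) (c i)) \<subseteq> fine_lists (X i) d (Suc i)" for j
      using ck i by (intro keys_map_isometry[OF T[OF i] isom]) simp
    have pow: "map_chain snd (sort_chain (map_chain lab ((map_chain T ^^ j) (c i))))
        = (map_chain (shift (int p)) ^^ j) (e i)" for j
      by (induction j) (simp_all add: e_def lin[OF keysT])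
    have sort_sum: "sort_chain (sum f A) = (\<Sum>a\<in>A. sort_chain (f a))"
      for f :: "nat \<Rightarrow> (nat \<times> int) chain" and A
      by (induction A rule: infinite_finite_induct) simp_all
    have "bd (e (Suc i)) = map_chain snd (sort_chain (map_chain lab (bd (c (Suc i)))))"
      using ck'[of "Suc i"] i by (simp add: e_def bd_sort_chain subset_iff)
    also have "\<dots> = cyclic_op p i (shift (int p)) (e i)"
      using pow[of 1] unfolding cb[OF i] cyclic_op_def
      by (simp add: e_def map_chain_sum sort_sum pow[unfolded e_def])
    finally show "bd (e (Suc i)) = cyclic_op p i (shift (int p)) (e i)" .
  qed
  moreover have "sort_chain (map_chain lab (c n)) = 0"
    using ck'[of n] by (intro sort_chain_eq_0[of _ n]) auto
  ultimately show False by (simp add: e_def)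
qed

subsection \<open>Equivariant maps on spheres\<close>

text \<open>Moving straight towards \<open>v i\<close> and normalising contracts the spherical part
  of one cone inside the next, where \<open>C i\<close> need not be a linear subspace. The last
  spherical part shrinks radially to the centre of the ball, which is added as stage
  \<open>n\<close>.\<close>

lemma cone_filtration_zero:
  fixes C :: "nat \<Rightarrow> 'v::euclidean_space set" and F :: "'v \<Rightarrow> 'b::{topological_space, zero}"
  assumes n: "n > 0"
    and closed: "\<And>i. i < n \<Longrightarrow> closed (C i)"
    and zero: "\<And>i. i < n \<Longrightarrow> 0 \<in> C i"
    and scale: "\<And>i x a. i < n \<Longrightarrow> x \<in> C i \<Longrightarrow> a \<ge> 0 \<Longrightarrow> a *\<^sub>R x \<in> C i"
    and v: "\<And>i. Suc i < n \<Longrightarrow> v i \<noteq> 0 \<and> - v i \<notin> C i"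
    and add: "\<And>i x a. Suc i < n \<Longrightarrow> x \<in> C i \<Longrightarrow> a \<ge> 0 \<Longrightarrow> x + a *\<^sub>R v i \<in> C (Suc i)"
    and u: "u \<in> C 0" "u \<noteq> 0"
    and T: "linear T" "\<And>x. norm (T x) = norm x" "T ^^ p = id" "\<And>i. i < n \<Longrightarrow> T ` C i \<subseteq> C i"
    and p: "p \<ge> 2"
    and F: "continuous_on (cball 0 1) F"
    and D: "\<And>i g. i < n \<Longrightarrow> g < p \<Longrightarrow> closed (D i g)"
    and cover: "\<And>y. y \<noteq> 0 \<Longrightarrow> \<exists>i<n. \<exists>g<p. y \<in> D i g"
    and disj: "\<And>y i g g'. i < n \<Longrightarrow> g < p \<Longrightarrow> g' < p \<Longrightarrow> y \<in> D i g \<Longrightarrow> y \<in> D i g' \<Longrightarrow> y \<noteq> 0 \<Longrightarrow> g = g'"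
    and equiv: "\<And>x i g. norm x = 1 \<Longrightarrow> i < n \<Longrightarrow> g < p \<Longrightarrow> F x \<in> D i g \<Longrightarrow> F (T x) \<in> D i (Suc g mod p)"
  shows "\<exists>x\<in>cball 0 1. F x = 0"
proof -
  define X where "X = (\<lambda>i. if i < n then C i \<inter> sphere 0 1 else cball 0 1)"
  have Xn: "X n = cball 0 1" by (simp add: X_def)
  have "\<exists>x\<in>X n. F x = 0"
  proof (rule cyclic_equivariant_zero[where T = T and p = p and D = D])
    show "compact (X i)" for i
      using closed by (auto simp: X_def intro: closed_Int_compact)
    show "X i \<subseteq> X n" if "i < n" for i
      using that by (auto simp: X_def)
    show "u /\<^sub>R norm u \<in> X 0"
      using n u scale[of 0 u "inverse (norm u)"] by (simp add: X_def)
    show "T ` X i \<subseteq> X i" if "i < n" for i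
      using T(2) T(4)[OF that] that by (auto simp: X_def)
    show "dist (T x) (T y) = dist x y" for x y
      unfolding dist_norm by (metis T(1,2) linear_diff)
    show "continuous_on (X n) F" using F Xn by simp
  next
    fix i assume i: "i < n"
    show "\<exists>H y. continuous_on ({0..1::real} \<times> X i) H \<and> H ` ({0..1} \<times> X i) \<subseteq> X (Suc i) \<and>
      (\<forall>x\<in>X i. H (0, x) = x \<and> H (1, x) = y) \<and> y \<in> X (Suc i)"
    proof (cases "Suc i < n")
      case False
      then have Xi: "X (Suc i) = cball 0 1" "X i = C i \<inter> sphere 0 1"
        using i by (auto simp: X_def)
      have "norm ((1 - t) *\<^sub>R x) \<le> 1" if "t \<in> {0..1}" "norm x = 1" for t :: real and x :: 'v
        using that by simp
      then show ?thesis
        unfolding Xi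
        by (intro exI[of _ "\<lambda>z. (1 - fst z) *\<^sub>R snd z"] exI[of _ 0]) (auto intro!: continuous_intros)
    next
      case True
      then have Xi: "X (Suc i) = C (Suc i) \<inter> sphere 0 1" "X i = C i \<inter> sphere 0 1"
        using i by (auto simp: X_def)
      define h where "h = (\<lambda>z. (1 - fst z) *\<^sub>R snd z + fst z *\<^sub>R v i)"
      have nz: "h (t, x) \<noteq> 0" if "t \<in> {0..1}" "x \<in> C i" "norm x = 1" for t :: real and x
      proof
        \<comment> \<open>At such a \<open>t\<close> the vector \<open>- v i\<close> would be a
          nonnegative multiple of \<open>x\<close>, hence a point of the cone
          \<open>C i\<close>.\<close>
        assume 0: "h (t, x) = 0"
        have "t \<noteq> 0" using 0 that(3) by (auto simp: h_def)
        have "v i = (1 / t) *\<^sub>R (t *\<^sub>R v i)" using \<open>t \<noteq> 0\<close> by simp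
        also have "t *\<^sub>R v i = - ((1 - t) *\<^sub>R x)" using 0 by (simp add: h_def add_eq_0_iff)
        finally have "- v i = ((1 - t) / t) *\<^sub>R x" by simp
        moreover have "((1 - t) / t) *\<^sub>R x \<in> C i"
          using that \<open>t \<noteq> 0\<close> by (intro scale[OF i]) auto
        ultimately show False using v[OF True] by simp
      qed
      have inC: "h (t, x) \<in> C (Suc i)" if "t \<in> {0..1}" "x \<in> C i" for t :: real and x
        using that unfolding h_def fst_conv snd_conv by (intro add[OF True] scale[OF i]) auto
      define H where "H = (\<lambda>z. h z /\<^sub>R norm (h z))"
      have "continuous_on ({0..1} \<times> X i) H"
        unfolding H_def using nz
        by (auto simp: h_def Xi intro!: continuous_intros)
      moreover have "H ` ({0..1} \<times> X i) \<subseteq> X (Suc i)"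
        using nz inC True by (auto simp: Xi H_def intro!: scale)
      moreover have "H (0, x) = x" "H (1, x) = v i /\<^sub>R norm (v i)" if "x \<in> X i" for x
        using that by (auto simp: H_def h_def Xi)
      moreover have "v i /\<^sub>R norm (v i) \<in> X (Suc i)"
        using v[OF True] add[OF True zero[OF i], of "inverse (norm (v i))"] by (simp add: Xi)
      ultimately show ?thesis by blast
    qed
  next
    fix x i j g assume "j < n" "x \<in> X j" "i < n" "g < p" "F x \<in> D i g"
    then show "F (T x) \<in> D i (Suc g mod p)"
      by (intro equiv) (auto simp: X_def)
  qed (use p T(3) D cover disj in blast)+
  then show ?thesis by (simp add: Xn)
qed

section \<open>Roots of unity, sectors and complex coordinates\<close>

definition primitive_root :: "nat \<Rightarrow> 'a::monoid_mult \<Rightarrow> bool"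
  where "primitive_root p z \<longleftrightarrow> p > 0 \<and> z ^ p = 1 \<and> (\<forall>k. 0 < k \<longrightarrow> k < p \<longrightarrow> z ^ k \<noteq> 1)"

lemma power_power_eq_1: "z ^ p = 1 \<Longrightarrow> (z ^ g) ^ p = (1::'a::monoid_mult)"
  by (metis mult.commute power_mult power_one)

lemma primitive_root_nonzero: "primitive_root p z \<Longrightarrow> z \<noteq> (0::'a::division_ring)"
  by (auto simp: primitive_root_def power_0_left)

lemma primitive_root_norm:
  assumes "primitive_root p z"
  shows "norm (z::'a::real_normed_div_algebra) = 1"
proof (rule power_eq_imp_eq_base)
  show "norm z ^ p = 1 ^ p" "p > 0"
    using assms by (simp_all add: primitive_root_def flip: norm_power)
qed simp_all

lemma primitive_root_inj:
  fixes z :: "'a::division_ring"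
  assumes z: "primitive_root p z" and "g < p" "g' < p" "z ^ g = z ^ g'"
  shows "g = g'"
proof -
  have False if "a < b" "b < p" "z ^ a = z ^ b" for a b
  proof -
    have "z ^ b = z ^ a * z ^ (b - a)"
      using that(1) by (simp flip: power_add)
    then have "z ^ a * z ^ (b - a) = z ^ a * 1"
      using that(3) by simp
    then have "z ^ (b - a) = 1"
      using primitive_root_nonzero[OF z] by simp
    with that z show False by (auto simp: primitive_root_def)
  qed
  with assms show ?thesis by (metis nat_neq_iff)
qed

lemma primitive_root_complex_powers:
  fixes z w :: complex
  assumes z: "primitive_root p z" and w: "w ^ p = 1"
  shows "\<exists>g<p. w = z ^ g"
proof -
  have p: "p > 0" "z ^ p = 1" using z by (auto simp: primitive_root_def)
  have "(\<lambda>g. z ^ g) ` {..<p} \<subseteq> {w. w ^ p = 1}"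
    using p by (auto intro: power_power_eq_1)
  moreover have "card ((\<lambda>g. z ^ g) ` {..<p}) = p"
    using primitive_root_inj[OF z] by (subst card_image) (auto simp: inj_on_def)
  ultimately have "(\<lambda>g. z ^ g) ` {..<p} = {w. w ^ p = 1}"
    using p by (intro card_subset_eq) (auto simp: card_nth_roots)
  with w show ?thesis by blast
qed

text \<open>For \<open>t < 2\<close>, one half of the closed fundamental domain of the rotation by
  \<open>2 * pi / p\<close>. The whole closed domain touches its rotated copies along edges (for
  \<open>p \<ge> 2\<close>); a half meets its own copies only in \<open>0\<close>. Letting the angle
  range over a compact interval yields closedness without the branch cut of an argument
  function.\<close>

definition sector :: "nat \<Rightarrow> nat \<Rightarrow> complex set"
  where "sector p t = {z. \<exists>s\<in>{0..1}. z = of_real (norm z) * cis (pi * (real t + s) / real p)}"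

lemma closed_sector:
  assumes "p > 0"
  shows "closed (sector p t)"
proof -
  have "closed {z. \<exists>s. s \<in> {0..1::real} \<and> (s, z) \<in> {q. snd q = of_real (norm (snd q)) * cis (pi * (real t + fst q) / real p)}}"
    using assms by (intro closed_compact_projection closed_Collect_eq compact_Icc continuous_intros) auto
  then show ?thesis by (simp add: sector_def Bex_def)
qed

text \<open>Taking the \<open>p\<close>-th power forgets the unknown rotation: if
  \<open>z ^ p\<close> has argument \<open>pi * a\<close>, then \<open>a\<close> splits into the
  half \<open>t\<close> and the position inside it, and \<open>z\<close> differs from the point at
  angle \<open>pi * a / p\<close> by a \<open>p\<close>-th root of unity. This works for every
  primitive \<open>w\<close>, not only the one of smallest angle.\<close>

lemma sector_cover:
  assumes w: "primitive_root p (w::complex)"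
  shows "\<exists>t<2. \<exists>g<p. inverse (w ^ g) * z \<in> sector p t"
proof (cases "z = 0")
  case True
  then show ?thesis using w
    by (auto simp: sector_def primitive_root_def intro!: exI[of _ "0::nat"] bexI[of _ "0::real"])
next
  case False
  have p: "p > 0" and wp: "w ^ p = 1" using w by (auto simp: primitive_root_def)
  define a where "a = Arg2pi (z ^ p) / pi"
  have a: "0 \<le> a" "a < 2" "z ^ p = of_real (norm z ^ p) * cis (pi * a)"
    using Arg2pi[of "z ^ p"] by (auto simp: a_def is_Arg_def field_simps cis_conv_exp norm_power)
  define t where "t = (if a < 1 then 0 else 1 :: nat)"
  define x where "x = cis (pi * a / real p)"
  have xp: "x ^ p = cis (pi * a)" unfolding x_def Complex.DeMoivre using p by simp
  have "(z / (of_real (norm z) * x)) ^ p = 1"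
    using False a(3) by (simp add: power_divide power_mult_distrib xp)
  then obtain g where g: "g < p" "z / (of_real (norm z) * x) = w ^ g"
    using primitive_root_complex_powers[OF w] by metis
  have "w \<noteq> 0" using w by (rule primitive_root_nonzero)
  have "z = w ^ g * (of_real (norm z) * x)"
    using g(2) False by (simp add: field_simps x_def)
  then have *: "inverse (w ^ g) * z = of_real (norm z) * x"
    using \<open>w \<noteq> 0\<close> by (metis mult.assoc left_inverse mult_1 power_not_zero)
  have "norm (inverse (w ^ g) * z) = norm z"
    unfolding * by (simp add: norm_mult x_def)
  moreover have "x = cis (pi * (real t + (a - real t)) / real p)" "a - real t \<in> {0..1}"
    using a by (auto simp: x_def t_def)
  ultimately have "inverse (w ^ g) * z \<in> sector p t"
    unfolding sector_def mem_Collect_eq using * by (intro bexI[of _ "a - real t"]) simp_all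
  moreover have "t < 2" by (simp add: t_def)
  ultimately show ?thesis using g(1) by blast
qed

text \<open>The \<open>p\<close>-th powers determine \<open>s\<close> up to multiples of
  \<open>2\<close>, while two positions in one sector differ by at most \<open>1\<close>. So the
  positions agree, and then so do the powers of \<open>w\<close>.\<close>

lemma sector_disjoint:
  assumes w: "primitive_root p (w::complex)" and g: "g < p" "g' < p" and z: "z \<noteq> 0"
    and "inverse (w ^ g) * z \<in> sector p t" "inverse (w ^ g') * z \<in> sector p t"
  shows "g = g'"
proof -
  have p: "p > 0" and wp: "w ^ p = 1" using w by (auto simp: primitive_root_def)
  have "w \<noteq> 0" "norm w = 1"
    using primitive_root_nonzero[OF w] primitive_root_norm[OF w] by auto
  obtain s where s: "s \<in> {0..1}" "inverse (w ^ g) * z = of_real (norm z) * cis (pi * (real t + s) / real p)"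
    using assms(5) \<open>norm w = 1\<close> by (auto simp: sector_def norm_mult norm_inverse norm_power)
  obtain s' where s': "s' \<in> {0..1}" "inverse (w ^ g') * z = of_real (norm z) * cis (pi * (real t + s') / real p)"
    using assms(6) \<open>norm w = 1\<close> by (auto simp: sector_def norm_mult norm_inverse norm_power)
  have zg: "z = of_real (norm z) * (w ^ g * cis (pi * (real t + s) / real p))"
    using s(2) \<open>w \<noteq> 0\<close> by (simp add: field_simps)
  have zg': "z = of_real (norm z) * (w ^ g' * cis (pi * (real t + s') / real p))"
    using s'(2) \<open>w \<noteq> 0\<close> by (simp add: field_simps)
  have eq: "w ^ g * cis (pi * (real t + s) / real p) = w ^ g' * cis (pi * (real t + s') / real p)"
    using zg zg' z by (metis mult_cancel_left norm_eq_zero of_real_eq_0_iff)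
  have "(w ^ g * cis (pi * (real t + s) / real p)) ^ p = cis (pi * (real t + s))" for g s
  proof -
    show ?thesis unfolding power_mult_distrib power_power_eq_1[OF wp] Complex.DeMoivre using p by simp
  qed
  then have "cis (pi * (real t + s)) = cis (pi * (real t + s'))"
    using eq by metis
  then have "cis (pi * (real t + s) - pi * (real t + s')) = 1"
    by (simp add: cis_divide[symmetric])
  then have "cos (pi * (s - s')) = 1"
    by (simp add: complex_eq_iff algebra_simps)
  then obtain m :: int where m: "pi * (s - s') = real_of_int m * 2 * pi"
    unfolding cos_one_2pi_int by blast
  then have "s - s' = 2 * real_of_int m" by simp
  moreover have "\<bar>s - s'\<bar> \<le> 1" using s(1) s'(1) by auto
  ultimately have "\<bar>2 * real_of_int m\<bar> \<le> 1" by simp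
  then have "m = 0" by linarith
  with m have "s = s'" by simp
  with eq have "w ^ g = w ^ g'" by simp
  then show ?thesis by (rule primitive_root_inj[OF w g])
qed

text \<open>Abstract coordinates \<open>K\<close> on the source and \<open>L\<close> on the target,
  with a separate multiplier for each, let complex and quaternionic spaces be treated together. Each
  target coordinate accounts for two indices, matching the two stages per complex line in the
  filtration.\<close>

theorem complex_equivariant_zero:
  fixes K :: "nat \<Rightarrow> 'v::euclidean_space \<Rightarrow> complex" and L :: "nat \<Rightarrow> 'w::{topological_space, zero} \<Rightarrow> complex"
  assumes M: "M > 0"
    and K: "\<And>j. j < M \<Longrightarrow> linear (K j)" and surj: "\<And>c. \<exists>x. \<forall>j<M. K j x = c j"
    and T: "linear T" "\<And>x. norm (T x) = norm x" "T ^^ p = id"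
    and KT: "\<And>j x. j < M \<Longrightarrow> K j (T x) = r j * K j x" and r: "\<And>j. j < M \<Longrightarrow> r j ^ p = 1"
    and L: "\<And>j. j < M \<Longrightarrow> continuous_on UNIV (L j)" "\<And>y. (\<forall>j<M. L j y = 0) \<Longrightarrow> y = 0"
    and p: "p \<ge> 2" and q: "\<And>j. j < M \<Longrightarrow> primitive_root p (q j)"
    and F: "continuous_on (cball 0 1) F"
    and equiv: "\<And>x j. norm x = 1 \<Longrightarrow> j < M \<Longrightarrow> L j (F (T x)) = q j * L j (F x)"
  shows "\<exists>x\<in>cball 0 1. F x = 0"
proof -
  \<comment> \<open>\<open>C (2 * j + 1)\<close> is spanned by the complex lines \<open>0, \<dots>, j\<close>; in \<open>C (2 * j)\<close> the last
    coordinate is confined to the rays through the \<open>p\<close>-th roots of unity.\<close>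
  define C where "C = (\<lambda>i. {x. (\<forall>l<M. i div 2 < l \<longrightarrow> K l x = 0) \<and> (even i \<longrightarrow> K (i div 2) x ^ p \<in> \<real>\<^sub>\<ge>\<^sub>0)})"
  obtain b where b: "\<And>j j' c. j < M \<Longrightarrow> j' < M \<Longrightarrow> K j' (b j c) = (if j' = j then c else 0)"
  proof -
    have "\<exists>x. \<forall>j'<M. K j' x = (if j' = j then c else 0)" for j c
      using surj[of "\<lambda>j'. if j' = j then c else 0"] .
    then obtain b where "\<And>j c. \<forall>j'<M. K j' (b j c) = (if j' = j then c else 0)" by metis
    then show thesis using that by blast
  qed
  \<comment> \<open>For even \<open>i\<close> the vector \<open>- v i\<close> has coordinate
    \<open>cis (pi / real p)\<close>, whose \<open>p\<close>-th power is \<open>-1\<close>, so it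
    lies off the rays. For odd \<open>i\<close> a new line is entered along its ray through
    \<open>1\<close>.\<close>
  define v where "v = (\<lambda>i. if even i then b (i div 2) (- cis (pi / real p)) else b (Suc (i div 2)) 1)"
  \<comment> \<open>Choosing a coordinate of largest modulus ensures that it is nonzero when
    \<open>y\<close> is, as disjointness of the sectors needs; ties are allowed in order to keep the
    sets closed.\<close>
  define D where "D = (\<lambda>i g. {y. (\<forall>l<M. norm (L l y) \<le> norm (L (i div 2) y)) \<and>
      inverse (q (i div 2) ^ g) * L (i div 2) y \<in> sector p (i mod 2)})"
  have div: "i div 2 < M" if "i < 2 * M" for i using that by auto
  have qnz: "q j \<noteq> 0" and qp: "q j ^ p = 1" and qn: "norm (q j) = 1" if "j < M" for j
    using q[OF that] primitive_root_nonzero primitive_root_norm by (auto simp: primitive_root_def)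
  show ?thesis
  proof (rule cone_filtration_zero[where n = "2 * M" and C = C and v = v and u = "b 0 1" and T = T and p = p and D = D])
    show "0 < 2 * M" using M by simp
    fix i assume i: "i < 2 * M"
    have lin: "K l 0 = 0" "K l (a *\<^sub>R x) = a *\<^sub>R K l x" "K l (x + y) = K l x + K l y" "K l (- x) = - K l x"
      if "l < M" for l a x y
      using K[OF that] by (simp_all add: linear_0 linear_scale linear_add linear_neg)
    have cont: "continuous_on S (K l)" if "l < M" for l S
      using K[OF that] by (rule linear_continuous_on[OF linear_conv_bounded_linear[THEN iffD1]])
    show "closed (C i)"
    proof -
      have "C i = (\<Inter>l\<in>{i div 2<..<M}. K l -` {0}) \<inter> (if even i then (\<lambda>x. K (i div 2) x ^ p) -` \<real>\<^sub>\<ge>\<^sub>0 else UNIV)"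
        by (auto simp: C_def)
      moreover have "closed (K l -` {0})" if "l < M" for l
        using cont[OF that] by (intro closed_vimage) auto
      moreover have "closed ((\<lambda>x. K (i div 2) x ^ p) -` \<real>\<^sub>\<ge>\<^sub>0)"
        using cont[OF div[OF i]] by (intro closed_vimage continuous_intros closed_nonneg_Reals_complex)
      ultimately show ?thesis by (auto intro!: closed_Int closed_INT)
    qed
    show "0 \<in> C i"
      using lin div[OF i] p by (simp add: C_def power_0_left)
    show "a *\<^sub>R x \<in> C i" if "x \<in> C i" "a \<ge> 0" for x a
      using that lin div[OF i] by (auto simp: C_def complex_nonneg_Reals_iff power_mult_distrib scaleR_conv_of_real
          simp flip: of_real_power)
    show "T ` C i \<subseteq> C i"
      using KT r div[OF i] by (auto simp: C_def power_mult_distrib)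
    show "closed (D i g)" if "g < p" for g
    proof -
      have "D i g = (\<Inter>l\<in>{..<M}. {y. norm (L l y) \<le> norm (L (i div 2) y)}) \<inter>
          (\<lambda>y. inverse (q (i div 2) ^ g) * L (i div 2) y) -` sector p (i mod 2)"
        by (auto simp: D_def)
      moreover have "closed {y. norm (L l y) \<le> norm (L (i div 2) y)}" if "l < M" for l
        using L(1)[OF that] L(1)[OF div[OF i]] by (intro closed_Collect_le continuous_intros)
      moreover have "closed ((\<lambda>y. inverse (q (i div 2) ^ g) * L (i div 2) y) -` sector p (i mod 2))"
        using L(1)[OF div[OF i]] closed_sector[of p] p
        by (intro closed_vimage) (auto intro!: continuous_intros)
      ultimately show ?thesis by (auto intro!: closed_Int closed_INT)
    qed
    show "g = g'" if "g < p" "g' < p" "y \<in> D i g" "y \<in> D i g'" "y \<noteq> 0" for y g g'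
    proof (rule sector_disjoint[OF q[OF div[OF i]] that(1,2)])
      show "L (i div 2) y \<noteq> 0"
      proof
        assume "L (i div 2) y = 0"
        then have "\<forall>l<M. L l y = 0" using that(3) by (auto simp: D_def)
        with L(2) that(5) show False by blast
      qed
    qed (use that in \<open>auto simp: D_def\<close>)
    show "F (T x) \<in> D i (Suc g mod p)" if "norm x = 1" "g < p" "F x \<in> D i g" for x g
    proof -
      let ?j = "i div 2"
      have "q ?j ^ (Suc g mod p) = q ?j ^ Suc g"
        using qp[OF div[OF i]] \<open>g < p\<close> by (cases "Suc g = p") auto
      then have "inverse (q ?j ^ (Suc g mod p)) * (q ?j * L ?j (F x)) = inverse (q ?j ^ g) * L ?j (F x)"
        using qnz[OF div[OF i]] by (simp add: field_simps)
      moreover have "norm (L l (F (T x))) = norm (L l (F x))" if "l < M" for l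
        using that by (simp add: equiv[OF \<open>norm x = 1\<close>] norm_mult qn)
      moreover have "L ?j (F (T x)) = q ?j * L ?j (F x)"
        using div[OF i] by (rule equiv[OF that(1)])
      ultimately show ?thesis
        using that(3) div[OF i] unfolding D_def mem_Collect_eq by metis
    qed
  next
    fix i assume i: "Suc i < 2 * M"
    have j: "i div 2 < M" "odd i \<Longrightarrow> Suc (i div 2) < M"
      using i by (auto elim!: oddE)
    have lin: "K l 0 = 0" "K l (a *\<^sub>R x) = a *\<^sub>R K l x" "K l (x + y) = K l x + K l y" "K l (- x) = - K l x"
      if "l < M" for l a x y
      using K[OF that] by (simp_all add: linear_0 linear_scale linear_add linear_neg)
    show "v i \<noteq> 0 \<and> - v i \<notin> C i"
    proof (cases "even i")
      case True
      have *: "K (i div 2) (v i) = - cis (pi / real p)"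
        using True j b by (simp add: v_def)
      have "cis (pi / real p) ^ p = -1"
        unfolding Complex.DeMoivre using p by simp
      then have "K (i div 2) (- v i) ^ p \<notin> \<real>\<^sub>\<ge>\<^sub>0"
        using * lin(4)[OF j(1)] by (simp add: complex_nonneg_Reals_iff)
      with True * lin(1)[OF j(1)] show ?thesis by (auto simp: C_def)
    next
      case False
      then have *: "K (Suc (i div 2)) (v i) = 1"
        using j b by (simp add: v_def)
      then have "K (Suc (i div 2)) (- v i) \<noteq> 0"
        using lin(4)[of "Suc (i div 2)"] j False by simp
      with False j * lin(1)[of "Suc (i div 2)"] show ?thesis by (fastforce simp: C_def)
    qed
    show "x + a *\<^sub>R v i \<in> C (Suc i)" if "x \<in> C i" "a \<ge> 0" for x a
    proof (cases "even i")
      case True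
      then show ?thesis
        using that j b lin by (auto simp: C_def v_def)
    next
      case False
      then have "Suc i div 2 = Suc (i div 2)" by (auto elim!: oddE)
      then show ?thesis
        using that j b lin False by (auto simp: C_def v_def complex_nonneg_Reals_iff simp flip: of_real_power)
    qed
  next
    show "b 0 1 \<in> C 0" "b 0 1 \<noteq> 0"
      using M b[of 0 _ 1] linear_0[OF K[OF M]] b[of 0 0 1] by (auto simp: C_def)
    show "\<exists>i<2 * M. \<exists>g<p. y \<in> D i g" if "y \<noteq> 0" for y
    proof -
      have "Max ((\<lambda>l. norm (L l y)) ` {..<M}) \<in> (\<lambda>l. norm (L l y)) ` {..<M}"
        using M by (intro Max_in) auto
      then obtain j where j: "j < M" "Max ((\<lambda>l. norm (L l y)) ` {..<M}) = norm (L j y)" by auto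
      then have max: "\<forall>l<M. norm (L l y) \<le> norm (L j y)"
        by (metis Max_ge finite_imageI finite_lessThan image_eqI lessThan_iff)
      obtain t g where t: "t < 2" "g < p" "inverse (q j ^ g) * L j y \<in> sector p t"
        using sector_cover[OF q[OF j(1)]] by blast
      have "(2 * j + t) div 2 = j" "(2 * j + t) mod 2 = t" "2 * j + t < 2 * M"
        using t(1) j(1) by auto
      with max t show ?thesis
        by (intro exI[of _ "2 * j + t"] conjI exI[of _ g]) (simp_all add: D_def)
    qed
  qed (use T p F in auto)
qed

section \<open>The zero theorem over the reals, the complex numbers and the quaternions\<close>

lemma scalar_mult_linear: "linear ((*s) z :: 'f::conj_div_algebra ^ 'm \<Rightarrow> 'f ^ 'm)"
  by (rule linearI) (simp_all add: vec_eq_iff distrib_left)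

lemma scalar_mult_norm: "norm (z *s x) = norm z * norm (x :: 'f::conj_div_algebra ^ 'm)"
  by (simp add: norm_vec_def norm_mult L2_set_right_distrib)

lemma scalar_mult_funpow: "((*s) z ^^ k) (x :: 'f::conj_div_algebra ^ 'm) = z ^ k *s x"
  by (induction k) (simp_all add: vec_eq_iff mult.assoc)

lemma scalar_mult_funpow_id:
  "z ^ p = 1 \<Longrightarrow> (*s) z ^^ p = (id :: 'f::conj_div_algebra ^ 'm \<Rightarrow> 'f ^ 'm)"
  by (simp add: fun_eq_iff scalar_mult_funpow)

lemma linear_component: "linear (\<lambda>x :: 'f::real_vector ^ 'm. x $ i)"
  by (rule linearI) simp_all

lemma enumeration: "\<exists>e. bij_betw e {..<CARD('m::finite)} (UNIV :: 'm set)"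
  using ex_bij_betw_nat_finite[of "UNIV :: 'm set"] by (simp add: atLeast0LessThan)

lemma primitive_root_real:
  assumes "primitive_root p (z::real)" "p \<ge> 2"
  shows "z = -1 \<and> p = 2"
proof -
  have ne: "0 < k \<Longrightarrow> k < p \<Longrightarrow> z ^ k \<noteq> 1" for k
    using assms(1) by (simp add: primitive_root_def)
  from ne[of 1] have "\<bar>z\<bar> = 1" "z \<noteq> 1"
    using primitive_root_norm[OF assms(1)] assms(2) by auto
  then have z: "z = -1" by auto
  have "\<not> 2 < p"
    using ne[of 2] z by auto
  with z assms(2) show ?thesis by linarith
qed

text \<open>Only \<open>p = 2\<close> and \<open>z = -1\<close> can occur, so \<open>F\<close> is
  odd on the sphere. The filtration is by coordinate subspaces, and the two sets
  \<open>D i g\<close> are the cones over opposite facets of the cube.\<close>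

theorem equivariant_zero_real:
  fixes F :: "real ^ 'm \<Rightarrow> real ^ 'm"
  assumes "p \<ge> 2" "primitive_root p z" "\<And>j. primitive_root p (h j)"
    and F: "continuous_on (cball 0 1) F"
    and equiv: "\<And>x. norm x = 1 \<Longrightarrow> F (z *s x) = (\<chi> j. h j * F x $ j)"
  shows "\<exists>x\<in>cball 0 1. F x = 0"
proof -
  have p: "p = 2" and z: "z = -1" and h: "h j = -1" for j
    using assms(1-3) primitive_root_real by blast+
  have odd: "F (- x) = - F x" if "norm x = 1" for x
    using equiv[OF that] by (simp add: z h vec_eq_iff)
  obtain e :: "nat \<Rightarrow> 'm" where e: "bij_betw e {..<CARD('m)} UNIV"
    using enumeration by blast
  have e_inj: "e i = e j \<longleftrightarrow> i = j" if "i < CARD('m)" "j < CARD('m)" for i j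
    using e that by (auto simp: bij_betw_def inj_on_def)
  have e_surj: "\<exists>i<CARD('m). j = e i" for j
    using e by (auto simp: bij_betw_def image_def set_eq_iff)
  define C where "C = (\<lambda>i. {x :: real ^ 'm. \<forall>l<CARD('m). i < l \<longrightarrow> x $ e l = 0})"
  define D where "D = (\<lambda>i (g::nat). {y :: real ^ 'm. \<forall>l. \<bar>y $ l\<bar> \<le> (if g = 0 then y $ e i else - y $ e i)})"
  show ?thesis
  proof (rule cone_filtration_zero[where n = "CARD('m)" and C = C and v = "\<lambda>i. axis (e (Suc i)) 1"
        and u = "axis (e 0) 1" and T = uminus and p = p and D = D])
    show "closed (C i)" for i
    proof -
      have "C i = (\<Inter>l\<in>{i<..<CARD('m)}. (\<lambda>x. x $ e l) -` {0})"
        by (auto simp: C_def)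
      then show ?thesis
        by (auto intro!: closed_INT closed_vimage continuous_intros)
    qed
    show "closed (D i g)" for i g
      unfolding D_def by (cases "g = 0") (auto intro!: closed_Collect_all closed_Collect_le continuous_intros)
    show "axis (e (Suc i)) 1 \<noteq> (0::real^'m) \<and> - axis (e (Suc i)) 1 \<notin> C i" if "Suc i < CARD('m)" for i
      using that by (auto simp: C_def axis_eq_0_iff)
    show "x + a *\<^sub>R axis (e (Suc i)) 1 \<in> C (Suc i)" if "Suc i < CARD('m)" "x \<in> C i" for i x a
      using that e_inj by (auto simp: C_def axis_def)
    show "axis (e 0) 1 \<in> C 0"
      using e_inj by (auto simp: C_def axis_def)
    show "\<exists>i<CARD('m). \<exists>g<p. y \<in> D i g" if "y \<noteq> 0" for y
    proof -
      have "\<exists>j. \<forall>l. \<bar>y $ l\<bar> \<le> \<bar>y $ j\<bar>"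
        using Max_in[of "range (\<lambda>l. \<bar>y $ l\<bar>)"] Max_ge[of "range (\<lambda>l. \<bar>y $ l\<bar>)"] by fastforce
      then obtain j where max: "\<And>l. \<bar>y $ l\<bar> \<le> \<bar>y $ j\<bar>" by blast
      obtain i where i: "i < CARD('m)" "j = e i" using e_surj by blast
      have "y \<in> D i (if y $ j \<ge> 0 then 0 else 1)"
        using max by (auto simp: D_def i(2))
      with i(1) p show ?thesis by (metis one_less_numeral_iff pos2 semiring_norm(76))
    qed
    show "g = g'" if "i < CARD('m)" "g < p" "g' < p" "y \<in> D i g" "y \<in> D i g'" "y \<noteq> 0" for y i g g'
    proof (rule ccontr)
      assume "g \<noteq> g'"
      then have "(g = 0) \<noteq> (g' = 0)" using that(2,3) p by auto
      then have "\<bar>y $ l\<bar> \<le> 0" for l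
        using that(4,5) unfolding D_def mem_Collect_eq by (smt (verit, ccfv_threshold))
      then have "y = 0" by (simp add: vec_eq_iff)
      with that(6) show False by simp
    qed
    show "F (- x) \<in> D i (Suc g mod p)" if "norm x = 1" "g < p" "F x \<in> D i g" for x i g
    proof -
      have "g = 0 \<or> g = 1" using that(2) p by auto
      then show ?thesis using that(3) p odd[OF that(1)] by (auto simp: D_def)
    qed
    show "uminus ^^ p = (id :: real ^ 'm \<Rightarrow> real ^ 'm)"
      by (simp add: p numeral_2_eq_2 fun_eq_iff)
  qed (auto simp: C_def p F axis_eq_0_iff linear_uminus)
qed

theorem equivariant_zero_complex:
  fixes F :: "complex ^ 'm \<Rightarrow> complex ^ 'm"
  assumes "p \<ge> 2" and z: "primitive_root p z" and "\<And>j. primitive_root p (h j)"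
    and "continuous_on (cball 0 1) F"
    and equiv: "\<And>x. norm x = 1 \<Longrightarrow> F (z *s x) = (\<chi> j. h j * F x $ j)"
  shows "\<exists>x\<in>cball 0 1. F x = 0"
proof -
  obtain e :: "nat \<Rightarrow> 'm" where e: "bij_betw e {..<CARD('m)} UNIV"
    using enumeration by blast
  define e' where "e' = inv_into {..<CARD('m)} e"
  have e_surj: "e' j < CARD('m)" "e (e' j) = j" for j
    using e bij_betw_inv_into_right[OF e, of j] bij_betwE[OF bij_betw_inv_into[OF e]]
    by (auto simp: e'_def)
  have e_inj: "e' (e i) = i" if "i < CARD('m)" for i
    using bij_betw_inv_into_left[OF e] that by (simp add: e'_def)
  show ?thesis
  proof (rule complex_equivariant_zero[where M = "CARD('m)" and K = "\<lambda>i x. x $ e i" and L = "\<lambda>i x. x $ e i"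
        and T = "(*s) z" and p = p and r = "\<lambda>_. z" and q = "\<lambda>i. h (e i)"])
    show "\<exists>x :: complex ^ 'm. \<forall>j<CARD('m). x $ e j = c j" for c
      by (intro exI[of _ "\<chi> j. c (e' j)"]) (simp add: e_inj)
    show "y = 0" if "\<forall>j<CARD('m). y $ e j = 0" for y :: "complex ^ 'm"
      using that e_surj by (metis vec_eq_iff zero_index)
    show "(*s) z ^^ p = (id :: complex ^ 'm \<Rightarrow> complex ^ 'm)" "z ^ p = 1"
      using z scalar_mult_funpow_id by (auto simp: primitive_root_def)
  qed (use assms primitive_root_norm[OF z] in \<open>auto simp: scalar_mult_norm scalar_mult_linear
      intro!: linear_component continuous_intros\<close>)
qed

text \<open>The quaternions are a left complex plane with basis \<open>1, j\<close>. After twisting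
  by an \<open>s\<close> that conjugates \<open>q\<close> into the complex numbers, left
  multiplication by \<open>q\<close> acts as the same scalar \<open>w\<close> on both coordinates.
  Linearity is over the reals.\<close>

definition complex_coordinates :: "quat \<Rightarrow> (nat \<Rightarrow> quat \<Rightarrow> complex) \<Rightarrow> complex \<Rightarrow> bool"
  where "complex_coordinates q k w \<longleftrightarrow>
    (\<forall>i. linear (k i)) \<and> (\<forall>i x. k i (q * x) = w * k i x) \<and>
    (\<forall>a b. \<exists>x. k 0 x = a \<and> k 1 x = b) \<and> (\<forall>x. k 0 x = 0 \<longrightarrow> k 1 x = 0 \<longrightarrow> x = 0)"

lemma complex_coordinates_exist: "\<exists>k w. complex_coordinates q k w"
proof -
  define k where "k = (\<lambda>i::nat. if i = 0 then (\<lambda>x. Complex (quat_re x) (quat_i x)) else (\<lambda>x. Complex (quat_j x) (quat_k x)))"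
  have k_lin: "linear (k i)" for i
    by (rule linearI) (auto simp: k_def plus_quat_def scaleR_quat_def complex_eq_iff)
  have k_mult: "k i (Quat a b 0 0 * x) = Complex a b * k i x" for i a b x
    by (auto simp: k_def times_quat_def complex_eq_iff)
  \<comment> \<open>\<open>q\<close> is conjugate to a quaternion in the complex subfield: if \<open>q = q0 + u\<close> with \<open>u\<close> purely
    imaginary of norm \<open>r\<close>, then \<open>s = r - i u\<close> satisfies \<open>s u = (r i) s\<close>.\<close>
  have "\<exists>s a b. s \<noteq> 0 \<and> s * q = Quat a b 0 0 * s"
  proof (cases "quat_j q = 0 \<and> quat_k q = 0")
    case True
    then show ?thesis
      by (intro exI[of _ 1] exI[of _ "quat_re q"] exI[of _ "quat_i q"] conjI zero_neq_one[symmetric])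
        (cases q, simp)
  next
    case False
    define r where "r = sqrt ((quat_i q)\<^sup>2 + (quat_j q)\<^sup>2 + (quat_k q)\<^sup>2)"
    have "r\<^sup>2 = (quat_i q)\<^sup>2 + (quat_j q)\<^sup>2 + (quat_k q)\<^sup>2"
      by (simp add: r_def)
    then have r: "r * r = quat_i q * quat_i q + quat_j q * quat_j q + quat_k q * quat_k q"
      by (simp add: power2_eq_square)
    let ?s = "Quat (r + quat_i q) 0 (quat_k q) (- quat_j q)"
    have "?s \<noteq> 0" using False by (auto simp: zero_quat_def)
    moreover have "?s * q = Quat (quat_re q) r 0 0 * ?s"
      using r by (simp add: times_quat_def algebra_simps)
    ultimately show ?thesis by blast
  qed
  then obtain s a b where s: "s \<noteq> 0" "s * q = Quat a b 0 0 * s" by blast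
  have "complex_coordinates q (\<lambda>i x. k i (s * x)) (Complex a b)"
    unfolding complex_coordinates_def
  proof (intro conjI allI impI)
    show "linear (\<lambda>x. k i (s * x))" for i
      using linear_compose[of "(*) s" "k i"] k_lin
      by (simp add: comp_def linear_iff distrib_left)
    show "k i (s * (q * x)) = Complex a b * k i (s * x)" for i x
      by (metis k_mult mult.assoc s(2))
    show "\<exists>x. k 0 (s * x) = c \<and> k 1 (s * x) = d" for c d
      using s(1) by (intro exI[of _ "inverse s * Quat (Re c) (Im c) (Re d) (Im d)"])
        (simp add: k_def flip: mult.assoc)
    show "x = 0" if "k 0 (s * x) = 0" "k 1 (s * x) = 0" for x
    proof -
      have "s * x = 0"
        using that by (auto simp: k_def quat_eq_iff zero_quat_def complex_eq_iff)
      with s(1) show ?thesis by simp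
    qed
  qed
  then show ?thesis by blast
qed

text \<open>\<open>q ^ m\<close> acts as \<open>w ^ m\<close> in coordinates that separate points,
  so \<open>q\<close> and \<open>w\<close> have the same order.\<close>

lemma complex_coordinates_root:
  assumes k: "complex_coordinates q k w" and q: "primitive_root p q"
  shows "primitive_root p w"
proof -
  have lin: "linear (k i)" for i
    using k by (simp add: complex_coordinates_def)
  have pow: "k i (q ^ m * x) = w ^ m * k i x" for i m x
    using k by (induction m) (simp_all add: mult.assoc complex_coordinates_def)
  obtain x1 where x1: "k 0 x1 = 1"
    using k unfolding complex_coordinates_def by blast
  have "q ^ m = 1 \<longleftrightarrow> w ^ m = 1" for m
  proof
    assume "q ^ m = 1"
    with pow[of 0 m x1] x1 show "w ^ m = 1" by simp
  next
    assume "w ^ m = 1"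
    then have "k i (q ^ m - 1) = 0" for i
      using pow[of i m 1] linear_diff[OF lin] by simp
    then have "q ^ m - 1 = 0" using k unfolding complex_coordinates_def by blast
    then show "q ^ m = 1" by simp
  qed
  with q show ?thesis by (auto simp: primitive_root_def)
qed

text \<open>The multipliers \<open>h j\<close> may differ from each other and from \<open>z\<close>,
  so each target coordinate receives its own complex coordinates. The index \<open>i\<close> stands
  for the complex part \<open>i mod 2\<close> of the quaternionic coordinate
  \<open>i div 2\<close>.\<close>

theorem equivariant_zero_quat:
  fixes F :: "quat ^ 'm \<Rightarrow> quat ^ 'm"
  assumes p: "p \<ge> 2" and z: "primitive_root p z" and h: "\<And>j. primitive_root p (h j)"
    and F: "continuous_on (cball 0 1) F"
    and equiv: "\<And>x. norm x = 1 \<Longrightarrow> F (z *s x) = (\<chi> j. h j * F x $ j)"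
  shows "\<exists>x\<in>cball 0 1. F x = 0"
proof -
  obtain e :: "nat \<Rightarrow> 'm" where e: "bij_betw e {..<CARD('m)} UNIV"
    using enumeration by blast
  define e' where "e' = inv_into {..<CARD('m)} e"
  have e_surj: "e' j < CARD('m)" "e (e' j) = j" for j
    using e bij_betw_inv_into_right[OF e, of j] bij_betwE[OF bij_betw_inv_into[OF e]]
    by (auto simp: e'_def)
  have e_inj: "e' (e i) = i" if "i < CARD('m)" for i
    using bij_betw_inv_into_left[OF e] that by (simp add: e'_def)
  obtain k w where kzw: "complex_coordinates z k w"
    using complex_coordinates_exist by blast
  then have k: "\<And>i. linear (k i)" "\<And>i x. k i (z * x) = w * k i x"
    "\<And>a b. \<exists>x. k 0 x = a \<and> k 1 x = b" "primitive_root p w"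
    using complex_coordinates_root[OF kzw z] by (auto simp: complex_coordinates_def)
  have "\<forall>j. \<exists>k w. complex_coordinates (h j) k w"
    using complex_coordinates_exist by simp
  then obtain K W where KW: "\<And>j. complex_coordinates (h j) (K j) (W j)"
    by (auto dest!: choice)
  have K: "\<And>j i. linear (K j i)" "\<And>j i x. K j i (h j * x) = W j * K j i x"
    "\<And>j x. K j 0 x = 0 \<Longrightarrow> K j 1 x = 0 \<Longrightarrow> x = 0" "\<And>j. primitive_root p (W j)"
    using KW complex_coordinates_root[OF KW h] by (auto simp: complex_coordinates_def)
  define N where "N = 2 * CARD('m)"
  have N: "2 * e' j < N" "Suc (2 * e' j) < N" for j
    using e_surj(1)[of j] by (auto simp: N_def)
  have div: "i div 2 < CARD('m)" if "i < N" for i using that by (auto simp: N_def)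
  show ?thesis
  proof (rule complex_equivariant_zero[where M = N and K = "\<lambda>i x. k (i mod 2) (x $ e (i div 2))"
        and L = "\<lambda>i x. K (e (i div 2)) (i mod 2) (x $ e (i div 2))"
        and T = "(*s) z" and p = p and r = "\<lambda>_. w" and q = "\<lambda>i. W (e (i div 2))"])
    show "N > 0" by (simp add: N_def)
    show "linear (\<lambda>x. k (i mod 2) (x $ e (i div 2)))" for i
      using linear_compose[OF linear_component k(1)] by (simp add: comp_def)
    show "\<exists>x :: quat ^ 'm. \<forall>i<N. k (i mod 2) (x $ e (i div 2)) = c i" for c
    proof -
      have "\<forall>j. \<exists>x. k 0 x = c (2 * e' j) \<and> k 1 x = c (Suc (2 * e' j))"
        using k(3) by blast
      then obtain f where f: "\<And>j. k 0 (f j) = c (2 * e' j) \<and> k 1 (f j) = c (Suc (2 * e' j))"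
        by (auto dest!: choice)
      have "k (i mod 2) (f (e (i div 2))) = c i" if "i < N" for i
      proof (cases "even i")
        case True
        then show ?thesis using f[of "e (i div 2)"] e_inj[OF div[OF that]] by simp
      next
        case False
        then have "Suc (2 * (i div 2)) = i" "i mod 2 = 1" by (auto elim!: oddE)
        then show ?thesis using f[of "e (i div 2)"] e_inj[OF div[OF that]] by simp
      qed
      then show ?thesis by (intro exI[of _ "\<chi> j. f j"]) simp
    qed
    show "(*s) z ^^ p = (id :: quat ^ 'm \<Rightarrow> quat ^ 'm)"
      using z scalar_mult_funpow_id by (auto simp: primitive_root_def)
    show "continuous_on UNIV (\<lambda>x. K (e (i div 2)) (i mod 2) (x $ e (i div 2)))" for i
      using linear_compose[OF linear_component K(1)]
      by (intro linear_continuous_on linear_conv_bounded_linear[THEN iffD1]) (simp add: comp_def)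
    show "y = 0" if "\<forall>i<N. K (e (i div 2)) (i mod 2) (y $ e (i div 2)) = 0" for y :: "quat ^ 'm"
    proof -
      have "y $ j = 0" for j
      proof (rule K(3)[of j])
        show "K j 0 (y $ j) = 0" using that[rule_format, OF N(1)[of j]] by (simp add: e_surj)
        show "K j 1 (y $ j) = 0" using that[rule_format, OF N(2)[of j]] by (simp add: e_surj)
      qed
      then show ?thesis by (simp add: vec_eq_iff)
    qed
    show "w ^ p = 1" using k(4) by (simp add: primitive_root_def)
  qed (use p F k K equiv primitive_root_norm[OF z] in \<open>auto simp: scalar_mult_norm scalar_mult_linear\<close>)
qed

subsection \<open>Continuity of vector-valued measures\<close>

definition sigma_additive :: "('a::topological_space set \<Rightarrow> 'b::real_normed_vector) \<Rightarrow> bool"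
  where "sigma_additive \<mu> \<longleftrightarrow> \<mu> {} = 0 \<and>
    (\<forall>E :: nat \<Rightarrow> 'a set. range E \<subseteq> sets borel \<and> disjoint_family E \<longrightarrow>
      summable (\<lambda>i. norm (\<mu> (E i))) \<and> (\<lambda>i. \<mu> (E i)) sums \<mu> (\<Union>i. E i))"

lemma sigma_additive_Un:
  assumes \<mu>: "sigma_additive \<mu>" and A: "A \<in> sets borel" "B \<in> sets borel" "A \<inter> B = {}"
  shows "\<mu> (A \<union> B) = \<mu> A + \<mu> B"
proof -
  have 0: "\<mu> {} = 0" using \<mu> by (simp add: sigma_additive_def)
  have "disjoint_family (binaryset A B)"
    using A(3) by (auto simp: disjoint_family_on_def binaryset_def)
  moreover have "range (binaryset A B) \<subseteq> sets borel"
    using A by (auto simp: range_binaryset_eq)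
  ultimately have "(\<lambda>i. \<mu> (binaryset A B i)) sums \<mu> (\<Union>i. binaryset A B i)"
    using \<mu> unfolding sigma_additive_def by blast
  then show ?thesis
    using sums_unique2 binaryset_sums[of \<mu> A B, OF 0] unfolding UN_binaryset_eq by blast
qed

lemma sigma_additive_split:
  assumes "sigma_additive \<mu>" "A \<in> sets borel" "B \<in> sets borel"
  shows "\<mu> A = \<mu> (A \<inter> B) + \<mu> (A - B)"
  using sigma_additive_Un[OF assms(1), of "A \<inter> B" "A - B"] assms(2,3) by (simp add: Int_Diff_Un Int_Diff_disjoint)

text \<open>The successive differences partition \<open>A 0\<close>, and their partial sums
  telescope to \<open>\<mu> (A 0) - \<mu> (A n)\<close>.\<close>

lemma sigma_additive_decseq_empty:
  assumes \<mu>: "sigma_additive \<mu>" and A: "range A \<subseteq> sets borel" "decseq A" "(\<Inter>i. A i) = {}"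
  shows "(\<lambda>n. \<mu> (A n)) \<longlonglongrightarrow> 0"
proof -
  define E where "E = (\<lambda>i. A i - A (Suc i))"
  have "disjoint_family E"
    unfolding disjoint_family_on_def
  proof (intro ballI impI)
    fix m n :: nat assume "m \<noteq> n"
    have "E i \<inter> E j = {}" if "i < j" for i j
      using decseqD[OF A(2), of "Suc i" j] that by (auto simp: E_def)
    with \<open>m \<noteq> n\<close> show "E m \<inter> E n = {}" by (metis Int_commute nat_neq_iff)
  qed
  moreover have "range E \<subseteq> sets borel" using A(1) by (auto simp: E_def)
  ultimately have "(\<lambda>i. \<mu> (E i)) sums \<mu> (\<Union>i. E i)"
    using \<mu> unfolding sigma_additive_def by blast
  moreover have "(\<Union>i. E i) = A 0"
  proof
    show "(\<Union>i. E i) \<subseteq> A 0" using decseqD[OF A(2)] by (auto simp: E_def)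
    show "A 0 \<subseteq> (\<Union>i. E i)"
    proof
      fix x assume x: "x \<in> A 0"
      have "\<exists>i. x \<notin> A i" using A(3) by blast
      then have "x \<notin> A (LEAST i. x \<notin> A i)" by (rule LeastI_ex)
      moreover obtain m where m: "(LEAST i. x \<notin> A i) = Suc m"
        using x calculation by (cases "LEAST i. x \<notin> A i") auto
      moreover have "x \<in> A m"
        using not_less_Least[of m "\<lambda>i. x \<notin> A i"] m by simp
      ultimately show "x \<in> (\<Union>i. E i)" by (auto simp: E_def)
    qed
  qed
  moreover have "(\<Sum>i<n. \<mu> (E i)) = \<mu> (A 0) - \<mu> (A n)" for n
  proof -
    have "\<mu> (E i) = \<mu> (A i) - \<mu> (A (Suc i))" for i
    proof -
      have "A i \<inter> A (Suc i) = A (Suc i)" using decseqD[OF A(2), of i "Suc i"] by auto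
      moreover have "\<mu> (A i) = \<mu> (A i \<inter> A (Suc i)) + \<mu> (A i - A (Suc i))"
        using A(1) by (intro sigma_additive_split[OF \<mu>]) auto
      ultimately show ?thesis by (simp add: E_def)
    qed
    then show ?thesis using sum_lessThan_telescope'[of "\<lambda>i. \<mu> (A i)" n] by simp
  qed
  ultimately have "(\<lambda>n. \<mu> (A 0) - \<mu> (A n)) \<longlonglongrightarrow> \<mu> (A 0)"
    by (simp add: sums_def)
  from tendsto_diff[OF tendsto_const[of "\<mu> (A 0)"] this] show ?thesis by simp
qed

text \<open>If the values stayed above \<open>\<epsilon>\<close>, one could cut pairwise disjoint sets with values of norm at least
  \<open>\<epsilon> / 2\<close> out of a subsequence, so no total variation is needed.\<close>

lemma sigma_additive_limsup_empty:
  fixes \<mu> :: "'a::topological_space set \<Rightarrow> 'b::real_normed_vector"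
  assumes \<mu>: "sigma_additive \<mu>" and E: "\<And>n. E n \<in> sets borel" "\<And>x. eventually (\<lambda>n. x \<notin> E n) sequentially"
  shows "(\<lambda>n. \<mu> (E n)) \<longlonglongrightarrow> 0"
proof (rule ccontr)
  assume "\<not> ?thesis"
  then obtain \<epsilon> where \<epsilon>: "\<epsilon> > 0" "\<And>N. \<exists>n\<ge>N. norm (\<mu> (E n)) \<ge> \<epsilon>"
    unfolding lim_sequentially by (auto simp: not_less)
  define A where "A = (\<lambda>n. \<Union>k\<in>{n..}. E k)"
  have A: "A n \<in> sets borel" for n
    unfolding A_def using E(1) by (intro sets.countable_UN') auto
  have "\<exists>n>m. norm (\<mu> (E m \<inter> A n)) < \<epsilon> / 2" for m
  proof -
    have "(\<lambda>n. \<mu> (E m \<inter> A n)) \<longlonglongrightarrow> 0"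
    proof (rule sigma_additive_decseq_empty[OF \<mu>])
      show "range (\<lambda>n. E m \<inter> A n) \<subseteq> sets borel" using A E(1) by auto
      show "decseq (\<lambda>n. E m \<inter> A n)" by (fastforce simp: decseq_def A_def)
      show "(\<Inter>n. E m \<inter> A n) = {}"
      proof -
        have "\<exists>n. x \<notin> A n" for x
          using E(2)[of x] by (auto simp: eventually_sequentially A_def)
        then show ?thesis by blast
      qed
    qed
    then have "eventually (\<lambda>n. norm (\<mu> (E m \<inter> A n)) < \<epsilon> / 2) sequentially"
      using order_tendstoD(2)[OF tendsto_norm_zero] half_gt_zero[OF \<epsilon>(1)] by blast
    then have "eventually (\<lambda>n. n > m \<and> norm (\<mu> (E m \<inter> A n)) < \<epsilon> / 2) sequentially"
      using eventually_gt_at_top[of m] by eventually_elim simp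
    then show ?thesis by (auto simp: eventually_sequentially)
  qed
  then obtain N where N: "\<And>m. N m > m" "\<And>m. norm (\<mu> (E m \<inter> A (N m))) < \<epsilon> / 2" by metis
  obtain r where r: "\<And>n. r n \<ge> n" "\<And>n. norm (\<mu> (E (r n))) \<ge> \<epsilon>" using \<epsilon>(2) by metis
  define s where "s = rec_nat (r 0) (\<lambda>_ m. r (N m))"
  have s: "s (Suc i) = r (N (s i))" for i by (simp add: s_def)
  have s_step: "N (s i) \<le> s (Suc i)" for i using r(1) by (simp add: s)
  have "s i < s (Suc i)" for i using s_step[of i] N(1)[of "s i"] by simp
  then have mono: "s i \<le> s j" if "i \<le> j" for i j
    using that by (metis less_imp_le lift_Suc_mono_le)
  \<comment> \<open>The tail union removed from \<open>E (s i)\<close> contains every later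
    \<open>E (s j)\<close>, which makes these sets disjoint, and the removed part has value below
    half of \<epsilon> in norm.\<close>
  define D where "D = (\<lambda>i. E (s i) - A (N (s i)))"
  have "disjoint_family D"
    unfolding disjoint_family_on_def
  proof (intro ballI impI)
    fix m n :: nat assume "m \<noteq> n"
    have "D i \<inter> D j = {}" if "i < j" for i j
    proof -
      have "N (s i) \<le> s j" using s_step[of i] mono[of "Suc i" j] that by simp
      then show ?thesis by (auto simp: D_def A_def)
    qed
    with \<open>m \<noteq> n\<close> show "D m \<inter> D n = {}" by (metis Int_commute nat_neq_iff)
  qed
  moreover have "range D \<subseteq> sets borel" using E(1) A by (auto simp: D_def)
  ultimately have "summable (\<lambda>i. norm (\<mu> (D i)))"
    using \<mu> unfolding sigma_additive_def by blast
  then have "(\<lambda>i. norm (\<mu> (D i))) \<longlonglongrightarrow> 0" by (rule summable_LIMSEQ_zero)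
  then obtain i where i: "norm (\<mu> (D i)) < \<epsilon> / 2"
    using \<epsilon>(1) by (auto simp: lim_sequentially dest!: spec[of _ "\<epsilon> / 2"])
  have "norm (\<mu> (E (s i))) \<ge> \<epsilon>" using r(2) by (cases i) (simp_all add: s_def)
  moreover have "norm (\<mu> (E (s i))) = norm (\<mu> (E (s i) \<inter> A (N (s i))) + \<mu> (D i))"
    unfolding D_def by (rule arg_cong[OF sigma_additive_split[OF \<mu> E(1) A]])
  ultimately show False
    using N(2)[of "s i"] i norm_triangle_ineq[of "\<mu> (E (s i) \<inter> A (N (s i)))" "\<mu> (D i)"] by linarith
qed

text \<open>Off \<open>N\<close> every point eventually leaves both differences of
  \<open>E n\<close> and \<open>F\<close>, so their values tend to zero. Since cancellation is
  possible, \<open>\<mu> N = 0\<close> would not suffice to discard \<open>N\<close>; all its Borel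
  subsets must have value zero.\<close>

lemma sigma_additive_tendsto:
  assumes \<mu>: "sigma_additive \<mu>" and E: "\<And>n. E n \<in> sets borel" "F \<in> sets borel"
    and N: "N \<in> sets borel" "\<And>B. B \<in> sets borel \<Longrightarrow> B \<subseteq> N \<Longrightarrow> \<mu> B = 0"
    and lim: "\<And>x. x \<notin> N \<Longrightarrow> eventually (\<lambda>n. x \<in> E n \<longleftrightarrow> x \<in> F) sequentially"
  shows "(\<lambda>n. \<mu> (E n)) \<longlonglongrightarrow> \<mu> F"
proof -
  have null: "\<mu> B = \<mu> (B - N)" if "B \<in> sets borel" for B
    using sigma_additive_split[OF \<mu> that N(1)] N(2)[of "B \<inter> N"] that N(1) by auto
  have ev: "eventually (\<lambda>n. x \<notin> E n - F - N \<and> x \<notin> F - E n - N) sequentially" for x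
  proof (cases "x \<in> N")
    case False
    from lim[OF this] show ?thesis by eventually_elim auto
  qed simp
  have "(\<lambda>n. \<mu> (E n - F - N)) \<longlonglongrightarrow> 0" "(\<lambda>n. \<mu> (F - E n - N)) \<longlonglongrightarrow> 0"
    using ev[unfolded eventually_conj_iff] E N(1) by (auto intro!: sigma_additive_limsup_empty[OF \<mu>])
  then have "(\<lambda>n. \<mu> F + (\<mu> (E n - F - N) - \<mu> (F - E n - N))) \<longlonglongrightarrow> \<mu> F + (0 - 0)"
    by (intro tendsto_intros)
  moreover have "\<mu> (E n) = \<mu> F + (\<mu> (E n - F - N) - \<mu> (F - E n - N))" for n
    using sigma_additive_split[OF \<mu> E(1)[of n] E(2)] sigma_additive_split[OF \<mu> E(2) E(1)[of n]]
      null[of "E n - F"] null[of "F - E n"] E by (simp add: Int_commute)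
  ultimately show ?thesis by simp
qed

lemma mass_distribution_sigma_additive: "mass_distribution \<mu> \<Longrightarrow> sigma_additive \<mu>"
  unfolding mass_distribution_def sigma_additive_def by blast

lemma mass_distribution_null:
  assumes \<mu>: "mass_distribution \<mu>" and S: "finite S" "\<And>s. s \<in> S \<Longrightarrow> w s \<noteq> 0"
    and B: "B \<in> sets borel" "B \<subseteq> (\<Union>s\<in>S. {u. w s \<bullet> u = c s})"
  shows "\<mu> B = 0"
  using S B
proof (induction S arbitrary: B rule: finite_induct)
  case empty
  then show ?case using \<mu> by (simp add: mass_distribution_def)
next
  case (insert s S)
  let ?h = "{u. w s \<bullet> u = c s}"
  have h: "?h \<in> sets borel" by (intro borel_closed closed_hyperplane)
  have "w \<noteq> 0 \<Longrightarrow> E \<in> sets borel \<Longrightarrow> E \<subseteq> {u. w \<bullet> u = c} \<Longrightarrow> \<mu> E = 0" for w c E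
    using \<mu> unfolding mass_distribution_def by blast
  from this[of "w s" "B \<inter> ?h" "c s"] have "\<mu> (B \<inter> ?h) = 0"
    using insert.prems h by auto
  moreover have "\<mu> (B - ?h) = 0"
    using insert.prems h by (intro insert.IH) auto
  ultimately show ?case
    using sigma_additive_split[OF mass_distribution_sigma_additive[OF \<mu>] insert.prems(2) h] by simp
qed

subsection \<open>The test map\<close>

text \<open>Half of what depends on \<open>g\<close>, with the sign reversed, in the squared
  distance from \<open>u\<close> to the site of \<open>g\<close> when \<open>a\<close> and
  \<open>g\<close> have norm one and \<open>b = - t\<close>. Unlike the distance comparison it
  distinguishes elements of \<open>G\<close> even at \<open>a = 0\<close>, and it is homogeneous in
  \<open>(a, t)\<close>.\<close>

definition score :: "real \<Rightarrow> 'f::conj_div_algebra ^ 'm::finite \<Rightarrow> 'f ^ 'm \<Rightarrow> 'f \<Rightarrow> real"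
  where "score t a u g = u \<bullet> (g *s a) + t * (1 \<bullet> g)"

definition score_region :: "'f::conj_div_algebra set \<Rightarrow> real \<Rightarrow> 'f ^ 'm::finite \<Rightarrow> 'f \<Rightarrow> ('f ^ 'm) set"
  where "score_region G t a g = {u. \<forall>g'\<in>G. score t a u g' \<le> score t a u g}"

lemma scalar_cnj_of_real: "scalar_cnj (of_real r :: 'f::conj_div_algebra) = of_real r"
proof (cases "r = 0")
  case False
  have "(of_real r :: 'f) * scalar_cnj (of_real r) = of_real r * of_real r"
    by (simp add: mult_scalar_cnj power2_eq_square scaleR_conv_of_real)
  with False show ?thesis by simp
qed (simp add: scalar_cnj_zero)

lemma voronoi_region_eq_score_region:
  fixes a :: "'f::conj_div_algebra ^ 'm::finite"
  assumes a: "norm a = 1" and G: "\<And>g. g \<in> G \<Longrightarrow> norm g = 1" and g: "g \<in> G"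
  shows "voronoi_region G a (of_real (- t)) g = score_region G t a g"
proof -
  have sq: "(norm (u - scalar_cnj (of_real (- t)) *s a - g *s a))\<^sup>2 =
      (norm u)\<^sup>2 + 2 * t * (u \<bullet> a) + 1 + t\<^sup>2 - 2 * score t a u g" if "g \<in> G" for u g
  proof -
    let ?w = "(g - of_real t) *s a"
    have w: "?w = g *s a - t *\<^sub>R a"
      by (simp add: vec_eq_iff left_diff_distrib scaleR_conv_of_real[where 'a = 'f])
    have 1: "u - scalar_cnj (of_real (- t)) *s a - g *s a = u - ?w"
      unfolding scalar_cnj_of_real by (simp add: vec_eq_iff left_diff_distrib)
    have 2: "(norm (u - ?w))\<^sup>2 = (norm u)\<^sup>2 - 2 * (u \<bullet> ?w) + (norm ?w)\<^sup>2"
      by (simp add: power2_norm_eq_inner inner_diff_left inner_diff_right inner_commute)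
    have 3: "u \<bullet> ?w = u \<bullet> (g *s a) - t * (u \<bullet> a)"
      unfolding w by (simp add: inner_diff_right)
    have 4: "(norm ?w)\<^sup>2 = 1 - 2 * t * (1 \<bullet> g) + t\<^sup>2"
    proof -
      have "(norm (g - of_real t))\<^sup>2 = (norm g)\<^sup>2 - 2 * (g \<bullet> of_real t) + (norm (of_real t :: 'f))\<^sup>2"
        by (simp only: power2_norm_eq_inner inner_diff_left inner_diff_right inner_commute)
      moreover have "g \<bullet> of_real t = t * (1 \<bullet> g)"
        by (simp add: of_real_def inner_commute)
      moreover have "norm ?w = norm (g - of_real t)"
        by (simp only: scalar_mult_norm a mult_1_right)
      ultimately show ?thesis
        using G[OF that] by simp
    qed
    show ?thesis unfolding 1 2 3 4 score_def by (simp add: algebra_simps)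
  qed
  have "norm (u - scalar_cnj (of_real (- t)) *s a - g *s a) \<le> norm (u - scalar_cnj (of_real (- t)) *s a - g' *s a)
      \<longleftrightarrow> score t a u g' \<le> score t a u g" if "g' \<in> G" for u g'
  proof -
    have "norm (u - scalar_cnj (of_real (- t)) *s a - g *s a) \<le> norm (u - scalar_cnj (of_real (- t)) *s a - g' *s a)
      \<longleftrightarrow> (norm (u - scalar_cnj (of_real (- t)) *s a - g *s a))\<^sup>2 \<le> (norm (u - scalar_cnj (of_real (- t)) *s a - g' *s a))\<^sup>2"
      by simp
    then show ?thesis unfolding sq[OF g] sq[OF that] by simp
  qed
  then show ?thesis
    unfolding voronoi_region_def score_region_def by blast
qed

lemma score_region_scale:
  assumes "c > 0"
  shows "score_region G (c * t) (c *\<^sub>R a) g = score_region G t a g"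
proof -
  have "score (c * t) (c *\<^sub>R a) u g = c * score t a u g" for u g
  proof -
    have "g *s (c *\<^sub>R a) = c *\<^sub>R (g *s a)" by (simp add: vec_eq_iff)
    then show ?thesis by (simp add: score_def algebra_simps)
  qed
  with assms show ?thesis by (simp add: score_region_def)
qed

text \<open>A left factor on \<open>a\<close> becomes a right factor on the label, which preserves
  left cosets of a subgroup containing it. The second term of the score lacks this symmetry, hence
  \<open>t = 0\<close>.\<close>

lemma score_region_mult:
  assumes G: "finite G" "h \<in> G" "h \<noteq> 0" "\<And>x. x \<in> G \<Longrightarrow> x * h \<in> G"
  shows "score_region G 0 (h *s a) g = score_region G 0 a (g * h)"
proof -
  have image: "(\<lambda>x. x * h) ` G = G"
    using G by (intro endo_inj_surj) (auto simp: inj_on_def)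
  have "score 0 (h *s a) u g = score 0 a u (g * h)" for u g
    by (simp add: score_def)
  then have "score_region G 0 (h *s a) g = {u. \<forall>x\<in>(\<lambda>x. x * h) ` G. score 0 a u x \<le> score 0 a u (g * h)}"
    by (simp add: score_region_def)
  then show ?thesis unfolding image score_region_def .
qed

lemma closed_score_region: "closed (score_region G t a g)"
proof -
  have "score_region G t a g = (\<Inter>g'\<in>G. {u. score t a u g' \<le> score t a u g})"
    by (auto simp: score_region_def)
  moreover have "closed {u. score t a u g' \<le> score t a u g}" for g'
    unfolding score_def by (intro closed_Collect_le continuous_intros)
  ultimately show ?thesis by auto
qed

text \<open>Away from ties, membership and non-membership are both witnessed by finitely many strict
  inequalities, and these persist near the limit.\<close>

lemma score_region_eventually:
  assumes G: "finite G" "g \<in> G" and lim: "a \<longlonglongrightarrow> a0" "t \<longlonglongrightarrow> t0"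
    and dich: "(\<forall>g'\<in>G - {g}. score t0 a0 u g' < score t0 a0 u g) \<or> (\<exists>g'\<in>G. score t0 a0 u g < score t0 a0 u g')"
  shows "eventually (\<lambda>n. u \<in> score_region G (t n) (a n) g \<longleftrightarrow> u \<in> score_region G t0 a0 g) sequentially"
proof -
  have conv: "(\<lambda>n. score (t n) (a n) u g) \<longlonglongrightarrow> score t0 a0 u g" for g
  proof -
    have "(\<lambda>n. g *s a n) \<longlonglongrightarrow> g *s a0"
      unfolding vector_scalar_mult_def by (intro tendsto_vec_lambda tendsto_intros lim)
    then show ?thesis unfolding score_def by (intro tendsto_intros lim)
  qed
  have lt: "eventually (\<lambda>n. score (t n) (a n) u g < score (t n) (a n) u g') sequentially"
    if "score t0 a0 u g < score t0 a0 u g'" for g g'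
  proof -
    have "(\<lambda>n. score (t n) (a n) u g' - score (t n) (a n) u g) \<longlonglongrightarrow> score t0 a0 u g' - score t0 a0 u g"
      by (intro tendsto_intros conv)
    from order_tendstoD(1)[OF this, of 0] that show ?thesis by simp
  qed
  from dich show ?thesis
  proof
    assume less: "\<forall>g'\<in>G - {g}. score t0 a0 u g' < score t0 a0 u g"
    then have "eventually (\<lambda>n. \<forall>g'\<in>G - {g}. score (t n) (a n) u g' < score (t n) (a n) u g) sequentially"
      using G(1) lt by (simp add: eventually_ball_finite)
    then show ?thesis
    proof eventually_elim
      case (elim n)
      have "u \<in> score_region G t a g" if *: "\<forall>g'\<in>G - {g}. score t a u g' < score t a u g" for t a
      proof -
        have "score t a u g' \<le> score t a u g" if "g' \<in> G" for g'
          using * that by (cases "g' = g") (auto intro: less_imp_le)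
        then show ?thesis by (simp add: score_region_def)
      qed
      with elim less show ?case by blast
    qed
  next
    assume "\<exists>g'\<in>G. score t0 a0 u g < score t0 a0 u g'"
    then obtain g' where g': "g' \<in> G" "score t0 a0 u g < score t0 a0 u g'" by blast
    from lt[OF g'(2)] show ?thesis
    proof eventually_elim
      case (elim n)
      have "u \<notin> score_region G (t n) (a n) g" "u \<notin> score_region G t0 a0 g"
        using elim g' unfolding score_region_def mem_Collect_eq by (meson not_le)+
      then show ?case by simp
    qed
  qed
qed

lemma inner_one_less:
  assumes "norm (g::'f::conj_div_algebra) = 1" "g \<noteq> 1"
  shows "1 \<bullet> g < 1 \<bullet> (1::'f)"
proof -
  have "0 < (norm (1 - g))\<^sup>2" using assms(2) by simp
  also have "(norm (1 - g))\<^sup>2 = 2 * (1 \<bullet> (1::'f)) - 2 * (1 \<bullet> g)"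
  proof -
    have "g \<bullet> g = 1 \<bullet> (1::'f)" using assms(1) by (simp add: dot_square_norm)
    then show ?thesis
      unfolding power2_norm_eq_inner inner_diff_left inner_diff_right by (simp only: inner_commute[of g 1])
  qed
  finally show ?thesis by simp
qed

text \<open>At \<open>a = 0\<close> the point \<open>1\<close> is the strict maximiser of the score, so the regions do not
  jump there although they are not determined by hyperplanes.\<close>

lemma score_region_tendsto:
  fixes \<mu> :: "('f::conj_div_algebra ^ 'm::finite) set \<Rightarrow> 'f"
  assumes \<mu>: "mass_distribution \<mu>" and G: "finite G" "1 \<in> G" "\<And>g. g \<in> G \<Longrightarrow> norm g = 1" and g: "g \<in> G"
    and lim: "a \<longlonglongrightarrow> a0" "t \<longlonglongrightarrow> t0" and nz: "a0 \<noteq> 0 \<or> t0 > 0"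
  shows "(\<lambda>n. \<mu> (score_region G (t n) (a n) g)) \<longlonglongrightarrow> \<mu> (score_region G t0 a0 g)"
proof -
  define S where "S = (if a0 = 0 then {} else {s \<in> G \<times> G. fst s \<noteq> snd s})"
  \<comment> \<open>Two elements of \<open>G\<close> tie exactly on the hyperplane of their pair;
    its normal is nonzero because a division algebra has no zero divisors.\<close>
  define N where "N = (\<Union>s\<in>S. {u. ((fst s - snd s) *s a0) \<bullet> u = t0 * (1 \<bullet> (snd s - fst s))})"
  have S: "finite S" using G(1) by (simp add: S_def)
  show ?thesis
  proof (rule sigma_additive_tendsto[OF mass_distribution_sigma_additive[OF \<mu>]])
    show "N \<in> sets borel"
      unfolding N_def using S by (intro sets.finite_UN borel_closed closed_hyperplane) auto
    show "\<mu> B = 0" if "B \<in> sets borel" "B \<subseteq> N" for B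
    proof (rule mass_distribution_null[OF \<mu> S _ that(1)])
      show "(fst s - snd s) *s a0 \<noteq> 0" if "s \<in> S" for s
        using that by (auto simp: S_def vec_eq_iff split: if_splits)
    qed (use that(2) in \<open>simp add: N_def\<close>)
    show "eventually (\<lambda>n. u \<in> score_region G (t n) (a n) g \<longleftrightarrow> u \<in> score_region G t0 a0 g) sequentially"
      if "u \<notin> N" for u
    proof (rule score_region_eventually[OF G(1) g lim])
      show "(\<forall>g'\<in>G - {g}. score t0 a0 u g' < score t0 a0 u g) \<or> (\<exists>g'\<in>G. score t0 a0 u g < score t0 a0 u g')"
      proof (cases "a0 = 0")
        case True
        then have less: "score t0 a0 u g < score t0 a0 u 1" if "g \<in> G" "g \<noteq> 1" for g
          using nz inner_one_less[OF G(3)[OF that(1)] that(2)] by (simp add: score_def)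
        show ?thesis
        proof (cases "g = 1")
          case True
          then show ?thesis using less by auto
        next
          case False
          then show ?thesis using less g G(2) by auto
        qed
      next
        case False
        have "score t0 a0 u g' \<noteq> score t0 a0 u g" if g': "g' \<in> G" "g' \<noteq> g" for g'
        proof
          assume eq: "score t0 a0 u g' = score t0 a0 u g"
          have "(g' - g) *s a0 = g' *s a0 - g *s a0"
            by (simp add: vec_eq_iff left_diff_distrib)
          then have "((g' - g) *s a0) \<bullet> u = t0 * (1 \<bullet> (g - g'))"
            using eq by (simp add: score_def inner_diff_left inner_diff_right right_diff_distrib inner_commute[of u])
          moreover have "(g', g) \<in> S" using False g g' by (simp add: S_def)
          ultimately have "u \<in> N" unfolding N_def by force
          with \<open>u \<notin> N\<close> show False by simp
        qed
        then have "score t0 a0 u g' < score t0 a0 u g \<or> score t0 a0 u g < score t0 a0 u g'" if "g' \<in> G - {g}" for g'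
          using that by (simp add: neq_iff)
        then show ?thesis by blast
      qed
    qed
  qed (simp_all add: borel_closed closed_score_region)
qed

section \<open>Equipartition over a general scalar algebra\<close>

lemma finite_group_primitive_root:
  assumes H: "finite H" "\<And>x y. x \<in> H \<Longrightarrow> y \<in> H \<Longrightarrow> x * y \<in> H" "1 \<in> H" "0 \<notin> H" and z: "z \<in> H" "z \<noteq> (1::'a::division_ring)"
  obtains p where "p \<ge> 2" "primitive_root p z"
proof -
  have pow: "z ^ k \<in> H" for k by (induction k) (use H z in auto)
  then have "\<not> inj (\<lambda>k. z ^ k)"
    using H(1) finite_imageD[of "\<lambda>k. z ^ k" UNIV] by (metis finite_subset image_subsetI infinite_UNIV_nat)
  then obtain i j where ij: "i < j" "z ^ i = z ^ j"
    unfolding inj_def by (metis nat_neq_iff)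
  have "z \<noteq> 0" using H(4) z(1) by auto
  have "z ^ j = z ^ i * z ^ (j - i)" using ij(1) by (simp flip: power_add)
  then have "z ^ i * z ^ (j - i) = z ^ i * 1" using ij(2) by simp
  then have "z ^ (j - i) = 1" using \<open>z \<noteq> 0\<close> by simp
  with ij(1) have ex: "\<exists>p. p > 0 \<and> z ^ p = 1" by (intro exI[of _ "j - i"]) simp
  define p where "p = (LEAST p. p > 0 \<and> z ^ p = 1)"
  have p: "p > 0 \<and> z ^ p = 1"
    unfolding p_def using ex by (rule LeastI_ex)
  have "z ^ k \<noteq> 1" if "0 < k" "k < p" for k
    using not_less_Least[of k "\<lambda>p. p > 0 \<and> z ^ p = 1"] that by (auto simp: p_def)
  with p have "primitive_root p z" by (simp add: primitive_root_def)
  moreover have "p \<noteq> 1" using p z(2) by auto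
  with p have "p \<ge> 2" by simp
  ultimately show thesis using that by blast
qed

text \<open>The zero theorem is the hypothesis \<open>BU\<close>, so that the argument is written
  once for the type class while each algebra supplies its own proof of it.\<close>

theorem voronoi_equipartition:
  fixes G :: "'f::conj_div_algebra set" and \<mu> :: "nat \<Rightarrow> ('f ^ 'm::finite) set \<Rightarrow> 'f"
  assumes BU: "\<And>p z h (F :: 'f ^ 'm \<Rightarrow> 'f ^ 'm). p \<ge> 2 \<Longrightarrow> primitive_root p z \<Longrightarrow> (\<And>j. primitive_root p (h j)) \<Longrightarrow>
      continuous_on (cball 0 1) F \<Longrightarrow> (\<And>x. norm x = 1 \<Longrightarrow> F (z *s x) = (\<chi> j. h j * F x $ j)) \<Longrightarrow>
      \<exists>x\<in>cball 0 1. F x = 0"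
    and finG: "finite G" and G: "subgroup G unit_sphere_group" and H: "subgroup H (mult_monoid G)" "H \<noteq> {1}"
    and reps: "left_coset_reps (mult_monoid G) H k g" and card: "CARD('m) = k * n"
    and \<mu>: "\<And>i. i \<in> {1..n} \<Longrightarrow> mass_distribution (\<mu> i)"
    and \<phi>: "\<And>l i. l \<in> {1..k} \<Longrightarrow> i \<in> {1..n} \<Longrightarrow> \<phi> l i \<in> iso (mult_monoid H) (mult_monoid H)"
  shows "\<exists>a b. a \<in> sphere 0 1 \<and> (\<forall>l\<in>{1..k}. \<forall>i\<in>{1..n}.
    (\<Sum>h\<in>H. inverse (\<phi> l i h) * \<mu> i (voronoi_region G a b (g l * h))) = 0)"
proof -
  have G1: "1 \<in> G" and Gn: "\<And>x. x \<in> G \<Longrightarrow> norm x = 1" and Gm: "\<And>x y. x \<in> G \<Longrightarrow> y \<in> G \<Longrightarrow> x * y \<in> G"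
    using subgroup.one_closed[OF G] subgroup.subset[OF G] subgroup.m_closed[OF G] by auto
  have H1: "1 \<in> H" and HG: "H \<subseteq> G" and Hm: "\<And>x y. x \<in> H \<Longrightarrow> y \<in> H \<Longrightarrow> x * y \<in> H"
    using subgroup.one_closed[OF H(1)] subgroup.subset[OF H(1)] subgroup.m_closed[OF H(1)] by auto
  have finH: "finite H" using finG HG finite_subset by blast
  have G0: "x \<noteq> 0" if "x \<in> G" for x using Gn[OF that] by auto
  have gG: "g l \<in> G" if "l \<in> {1..k}" for l using reps that by (auto simp: left_coset_reps_def)
  have \<phi>_hom: "\<phi> l i (x * y) = \<phi> l i x * \<phi> l i y" and \<phi>_H: "\<phi> l i x \<in> H"
    and \<phi>_inj: "inj_on (\<phi> l i) H"
    if "l \<in> {1..k}" "i \<in> {1..n}" "x \<in> H" "y \<in> H" for l i x y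
    using \<phi>[OF that(1,2)] that(3,4) by (auto simp: iso_def hom_def bij_betw_def)
  have \<phi>_nz: "\<phi> l i x \<noteq> 0" if "l \<in> {1..k}" "i \<in> {1..n}" "x \<in> H" for l i x
    using \<phi>_H[OF that that(3)] G0 HG by blast
  obtain z where z: "z \<in> H" "z \<noteq> 1" using H(2) H1 by blast
  obtain p where p: "p \<ge> 2" "primitive_root p z"
    using finite_group_primitive_root[OF finH Hm H1 _ z] HG G0 by blast
  have "card (UNIV :: 'm set) = card ({1..k} \<times> {1..n})" using card by simp
  then obtain e :: "'m \<Rightarrow> nat \<times> nat" where e: "bij_betw e UNIV ({1..k} \<times> {1..n})"
    using finite_same_card_bij[of "UNIV :: 'm set" "{1..k} \<times> {1..n}"] by auto
  define L where "L = (\<lambda>j. fst (e j))"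
  define I where "I = (\<lambda>j. snd (e j))"
  have LI: "L j \<in> {1..k}" "I j \<in> {1..n}" for j
    using bij_betwE[OF e] by (auto simp: L_def I_def mem_Times_iff)
  have LI_surj: "\<exists>j. L j = l \<and> I j = i" if "l \<in> {1..k}" "i \<in> {1..n}" for l i
  proof -
    have "(l, i) \<in> range e" using bij_betw_imp_surj_on[OF e] that by simp
    then obtain j where "e j = (l, i)" by auto
    then show ?thesis by (intro exI[of _ j]) (simp add: L_def I_def)
  qed
  define F where "F = (\<lambda>a :: 'f ^ 'm. \<chi> j. \<Sum>h\<in>H. inverse (\<phi> (L j) (I j) h) *
      \<mu> (I j) (score_region G (1 - norm a) a (g (L j) * h)))"
  have "\<exists>x\<in>cball 0 1. F x = 0"
  proof (rule BU[OF p])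
    fix j
    let ?\<phi> = "\<phi> (L j) (I j)"
    have one: "?\<phi> 1 = 1"
    proof -
      have "?\<phi> 1 \<noteq> 0" using \<phi>_nz[OF LI H1] .
      moreover have "?\<phi> 1 * ?\<phi> 1 = ?\<phi> 1 * 1" using \<phi>_hom[OF LI H1 H1] by simp
      ultimately show ?thesis by simp
    qed
    have zk: "z ^ k \<in> H" for k by (induction k) (use H1 Hm z in auto)
    have pow: "?\<phi> (z ^ k) = ?\<phi> z ^ k" for k
      by (induction k) (simp_all add: one \<phi>_hom[OF LI z(1) zk])
    \<comment> \<open>Injectivity of the automorphism transfers the exact order of \<open>z\<close>,
      which makes the action on this target coordinate free away from zero.\<close>
    have "?\<phi> z ^ k = 1 \<longleftrightarrow> z ^ k = 1" for k
      using \<phi>_inj[OF LI H1 H1] zk H1 one unfolding pow[symmetric] by (metis inj_on_eq_iff)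
    with p(2) show "primitive_root p (?\<phi> z)" by (simp add: primitive_root_def)
  next
    show "continuous_on (cball 0 1) F"
      unfolding continuous_on_sequentially comp_def
    proof (intro ballI allI impI, elim conjE)
      fix x and a0 :: "'f ^ 'm" assume lim: "x \<longlonglongrightarrow> a0"
      show "(\<lambda>n. F (x n)) \<longlonglongrightarrow> F a0"
        unfolding F_def
      proof (intro tendsto_vec_lambda tendsto_sum tendsto_mult tendsto_const)
        fix j h assume h: "h \<in> H"
        show "(\<lambda>n. \<mu> (I j) (score_region G (1 - norm (x n)) (x n) (g (L j) * h)))
            \<longlonglongrightarrow> \<mu> (I j) (score_region G (1 - norm a0) a0 (g (L j) * h))"
        proof (rule score_region_tendsto[OF \<mu>[OF LI(2)] finG G1 Gn])
          show "g (L j) * h \<in> G" using gG[OF LI(1)] h HG Gm by blast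
          show "(\<lambda>n. 1 - norm (x n)) \<longlonglongrightarrow> 1 - norm a0" by (intro tendsto_intros lim)
          show "a0 \<noteq> 0 \<or> 1 - norm a0 > 0" by auto
        qed (use lim in auto)
      qed
    qed
  next
    fix a :: "'f ^ 'm" assume a: "norm a = 1"
    have "norm (z *s a) = 1" using a Gn HG z(1) by (auto simp: scalar_mult_norm)
    have "(\<Sum>h\<in>H. inverse (\<phi> (L j) (I j) h) * \<mu> (I j) (score_region G 0 (z *s a) (g (L j) * h)))
        = \<phi> (L j) (I j) z * (\<Sum>h\<in>H. inverse (\<phi> (L j) (I j) h) * \<mu> (I j) (score_region G 0 a (g (L j) * h)))" for j
    proof -
      let ?\<phi> = "\<phi> (L j) (I j)"
      \<comment> \<open>The sum is reindexed by \<open>h * z\<close>: the region labelled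
        \<open>g (L j) * h\<close> for \<open>z *s a\<close> is the one labelled
        \<open>g (L j) * (h * z)\<close> for \<open>a\<close>, and
        \<open>inverse (?\<phi> h) = ?\<phi> z * inverse (?\<phi> (h * z))\<close> releases
        \<open>?\<phi> z\<close> on the left.\<close>
      have bij: "bij_betw (\<lambda>h. h * z) H H"
        unfolding bij_betw_def
      proof
        show "inj_on (\<lambda>h. h * z) H" using G0 HG z(1) by (auto simp: inj_on_def)
        then show "(\<lambda>h. h * z) ` H = H" using Hm z(1) finH by (intro endo_inj_surj) auto
      qed
      have "score_region G 0 (z *s a) x = score_region G 0 a (x * z)" for x
        using z(1) HG G0 Gm finG by (intro score_region_mult) auto
      moreover have "inverse (?\<phi> h) = ?\<phi> z * inverse (?\<phi> (h * z))" if "h \<in> H" for h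
      proof -
        have "?\<phi> h \<noteq> 0" "?\<phi> z \<noteq> 0" using \<phi>_nz[OF LI] that z(1) by blast+
        then show ?thesis
          by (simp add: \<phi>_hom[OF LI that z(1)] nonzero_inverse_mult_distrib flip: mult.assoc)
      qed
      ultimately have "(\<Sum>h\<in>H. inverse (?\<phi> h) * \<mu> (I j) (score_region G 0 (z *s a) (g (L j) * h)))
          = (\<Sum>h\<in>H. ?\<phi> z * (inverse (?\<phi> (h * z)) * \<mu> (I j) (score_region G 0 a (g (L j) * (h * z)))))"
        by (intro sum.cong) (auto simp: mult.assoc)
      also have "\<dots> = (\<Sum>h\<in>H. ?\<phi> z * (inverse (?\<phi> h) * \<mu> (I j) (score_region G 0 a (g (L j) * h))))"
        by (rule sum.reindex_bij_betw[OF bij])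
      finally show ?thesis by (simp add: sum_distrib_left)
    qed
    then show "F (z *s a) = (\<chi> j. \<phi> (L j) (I j) z * F a $ j)"
      by (simp add: F_def vec_eq_iff a \<open>norm (z *s a) = 1\<close>)
  qed
  then obtain a where Fa: "F a = 0" by blast
  have "a \<noteq> 0"
  proof
    assume "a = 0"
    \<comment> \<open>Some coset contains \<open>1\<close>. At \<open>a = 0\<close> the region of
      \<open>1\<close> is the whole space and all others are empty, so a coordinate belonging to
      this coset reduces to one nonzero multiple of the total mass.\<close>
    have "1 <#\<^bsub>mult_monoid G\<^esub> H \<in> lcosets\<^bsub>mult_monoid G\<^esub> H"
      using G1 by (auto simp: LCOSETS_def)
    also have "lcosets\<^bsub>mult_monoid G\<^esub> H = (\<lambda>l. g l <#\<^bsub>mult_monoid G\<^esub> H) ` {1..k}"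
      using reps by (simp add: left_coset_reps_def bij_betw_def)
    finally obtain l where l: "l \<in> {1..k}" "g l <#\<^bsub>mult_monoid G\<^esub> H = 1 <#\<^bsub>mult_monoid G\<^esub> H"
      by (metis (no_types, lifting) imageE)
    moreover have "1 \<in> 1 <#\<^bsub>mult_monoid G\<^esub> H"
      using H1 by (auto simp: l_coset_def)
    ultimately have "1 \<in> g l <#\<^bsub>mult_monoid G\<^esub> H" by simp
    then obtain h0 where h0: "h0 \<in> H" "g l * h0 = 1" by (auto simp: l_coset_def)
    have "n \<ge> 1" using card by (cases n) auto
    then obtain j where j: "L j = l" using LI_surj[of l 1] l(1) by auto
    have reg: "score_region G 1 (0 :: 'f ^ 'm) x = (if x = 1 then UNIV else {})" if "x \<in> G" for x
    proof (cases "x = 1")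
      case True
      have "1 \<bullet> g' \<le> 1 \<bullet> (1::'f)" if "g' \<in> G" for g'
        using inner_one_less[OF Gn[OF that]] by (cases "g' = 1") auto
      with True show ?thesis by (auto simp: score_region_def score_def)
    next
      case False
      have "\<not> score 1 (0 :: 'f ^ 'm) u 1 \<le> score 1 0 u x" for u
        using inner_one_less[OF Gn[OF that] False] by (simp add: score_def)
      then have "score_region G 1 (0 :: 'f ^ 'm) x = {}"
        using G1 unfolding score_region_def by blast
      with False show ?thesis by simp
    qed
    have "F a $ j = (\<Sum>h\<in>H. inverse (\<phi> l (I j) h) * \<mu> (I j) (if h = h0 then UNIV else {}))"
      unfolding F_def vec_lambda_beta j
    proof (intro sum.cong refl arg_cong2[of _ _ _ _ "(*)"] arg_cong[of _ _ "\<mu> (I j)"])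
      fix h assume h: "h \<in> H"
      have "g l * h = 1 \<longleftrightarrow> h = h0"
        using h0(2) G0[OF gG[OF l(1)]] by (metis mult_left_cancel)
      moreover have "g l * h \<in> G" using gG[OF l(1)] h HG Gm by blast
      ultimately show "score_region G (1 - norm a) a (g l * h) = (if h = h0 then UNIV else {})"
        using reg[of "g l * h"] \<open>a = 0\<close> by simp
    qed
    also have "\<dots> = (\<Sum>h\<in>H. if h = h0 then inverse (\<phi> l (I j) h0) * \<mu> (I j) UNIV else 0)"
      using \<mu>[OF LI(2)[of j]] by (intro sum.cong) (auto simp: mass_distribution_def)
    also have "\<dots> = inverse (\<phi> l (I j) h0) * \<mu> (I j) UNIV"
      using finH h0(1) by simp
    finally have "inverse (\<phi> l (I j) h0) * \<mu> (I j) UNIV = 0" using Fa by simp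
    moreover have "\<mu> (I j) UNIV \<noteq> 0" using \<mu>[OF LI(2)[of j]] by (simp add: mass_distribution_def)
    moreover have "\<phi> l (I j) h0 \<noteq> 0" using \<phi>_nz[OF l(1) LI(2)[of j] h0(1)] .
    ultimately show False by simp
  qed
  define t where "t = inverse (norm a) * (1 - norm a)"
  define a' where "a' = inverse (norm a) *\<^sub>R a"
  have a': "norm a' = 1" using \<open>a \<noteq> 0\<close> by (simp add: a'_def)
  have reg: "voronoi_region G a' (of_real (- t)) x = score_region G (1 - norm a) a x" if "x \<in> G" for x
  proof -
    have "voronoi_region G a' (of_real (- t)) x = score_region G t a' x"
      using a' Gn that by (rule voronoi_region_eq_score_region)
    also have "\<dots> = score_region G (1 - norm a) a x"
      unfolding t_def a'_def using \<open>a \<noteq> 0\<close> by (intro score_region_scale) simp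
    finally show ?thesis .
  qed
  show ?thesis
  proof (intro exI conjI ballI)
    show "a' \<in> sphere 0 1" using a' by simp
    fix l i assume li: "l \<in> {1..k}" "i \<in> {1..n}"
    then obtain j where j: "L j = l" "I j = i" using LI_surj by blast
    have "(\<Sum>h\<in>H. inverse (\<phi> l i h) * \<mu> i (voronoi_region G a' (of_real (- t)) (g l * h))) = F a $ j"
      unfolding F_def vec_lambda_beta j
      using reg gG[OF li(1)] Gm HG by (intro sum.cong) auto
    then show "(\<Sum>h\<in>H. inverse (\<phi> l i h) * \<mu> i (voronoi_region G a' (of_real (- t)) (g l * h))) = 0"
      using Fa by simp
  qed
qed

theorem theorem2:
  shows "
    (\<forall>(G :: real set) H k n g (\<mu> :: nat \<Rightarrow> (real ^ 'm::finite) set \<Rightarrow> real) \<phi>.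
      finite G \<and> subgroup G unit_sphere_group \<and>
      subgroup H (mult_monoid G) \<and> H \<noteq> {1} \<and>
      k = card (lcosets\<^bsub>mult_monoid G\<^esub> H) \<and> left_coset_reps (mult_monoid G) H k g \<and>
      n \<ge> 1 \<and> CARD('m) = k * n \<and>
      (\<forall>i\<in>{1..n}. mass_distribution (\<mu> i)) \<and>
      (\<forall>l\<in>{1..k}. \<forall>i\<in>{1..n}. \<phi> l i \<in> iso (mult_monoid H) (mult_monoid H)) \<longrightarrow>
      (\<exists>a b. a \<in> sphere 0 1 \<and>
        (\<forall>l\<in>{1..k}. \<forall>i\<in>{1..n}.
          (\<Sum>h\<in>H. inverse (\<phi> l i h) * \<mu> i (voronoi_region G a b (g l * h))) = 0))) \<and>
    (\<forall>(G :: complex set) H k n g (\<mu> :: nat \<Rightarrow> (complex ^ 'm::finite) set \<Rightarrow> complex) \<phi>.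
      finite G \<and> subgroup G unit_sphere_group \<and>
      subgroup H (mult_monoid G) \<and> H \<noteq> {1} \<and>
      k = card (lcosets\<^bsub>mult_monoid G\<^esub> H) \<and> left_coset_reps (mult_monoid G) H k g \<and>
      n \<ge> 1 \<and> CARD('m) = k * n \<and>
      (\<forall>i\<in>{1..n}. mass_distribution (\<mu> i)) \<and>
      (\<forall>l\<in>{1..k}. \<forall>i\<in>{1..n}. \<phi> l i \<in> iso (mult_monoid H) (mult_monoid H)) \<longrightarrow>
      (\<exists>a b. a \<in> sphere 0 1 \<and>
        (\<forall>l\<in>{1..k}. \<forall>i\<in>{1..n}.
          (\<Sum>h\<in>H. inverse (\<phi> l i h) * \<mu> i (voronoi_region G a b (g l * h))) = 0))) \<and>
    (\<forall>(G :: quat set) H k n g (\<mu> :: nat \<Rightarrow> (quat ^ 'm::finite) set \<Rightarrow> quat) \<phi>.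
      finite G \<and> subgroup G unit_sphere_group \<and>
      subgroup H (mult_monoid G) \<and> H \<noteq> {1} \<and>
      k = card (lcosets\<^bsub>mult_monoid G\<^esub> H) \<and> left_coset_reps (mult_monoid G) H k g \<and>
      n \<ge> 1 \<and> CARD('m) = k * n \<and>
      (\<forall>i\<in>{1..n}. mass_distribution (\<mu> i)) \<and>
      (\<forall>l\<in>{1..k}. \<forall>i\<in>{1..n}. \<phi> l i \<in> iso (mult_monoid H) (mult_monoid H)) \<longrightarrow>
      (\<exists>a b. a \<in> sphere 0 1 \<and>
        (\<forall>l\<in>{1..k}. \<forall>i\<in>{1..n}.
          (\<Sum>h\<in>H. inverse (\<phi> l i h) * \<mu> i (voronoi_region G a b (g l * h))) = 0)))"
proof (intro conjI allI impI; elim conjE)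
  fix G :: "real set" and H k n g and \<mu> :: "nat \<Rightarrow> (real ^ 'm) set \<Rightarrow> real" and \<phi>
  assume *: "finite G" "subgroup G unit_sphere_group" "subgroup H (mult_monoid G)" "H \<noteq> {1}"
    "left_coset_reps (mult_monoid G) H k g" "CARD('m) = k * n"
    "\<forall>i\<in>{1..n}. mass_distribution (\<mu> i)"
    "\<forall>l\<in>{1..k}. \<forall>i\<in>{1..n}. \<phi> l i \<in> iso (mult_monoid H) (mult_monoid H)"
  show "\<exists>a b. a \<in> sphere 0 1 \<and> (\<forall>l\<in>{1..k}. \<forall>i\<in>{1..n}.
      (\<Sum>h\<in>H. inverse (\<phi> l i h) * \<mu> i (voronoi_region G a b (g l * h))) = 0)"
  proof (rule voronoi_equipartition)
    show "\<exists>x\<in>cball 0 1. F x = 0"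
      if "p \<ge> 2" "primitive_root p z" "\<And>j. primitive_root p (h j)" "continuous_on (cball 0 1) F"
        "\<And>x. norm x = 1 \<Longrightarrow> F (z *s x) = (\<chi> j. h j * F x $ j)"
      for p z h and F :: "real ^ 'm \<Rightarrow> real ^ 'm"
      using that by (rule equivariant_zero_real)
  qed (use * in blast)+
next
  fix G :: "complex set" and H k n g and \<mu> :: "nat \<Rightarrow> (complex ^ 'm) set \<Rightarrow> complex" and \<phi>
  assume *: "finite G" "subgroup G unit_sphere_group" "subgroup H (mult_monoid G)" "H \<noteq> {1}"
    "left_coset_reps (mult_monoid G) H k g" "CARD('m) = k * n"
    "\<forall>i\<in>{1..n}. mass_distribution (\<mu> i)"
    "\<forall>l\<in>{1..k}. \<forall>i\<in>{1..n}. \<phi> l i \<in> iso (mult_monoid H) (mult_monoid H)"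
  show "\<exists>a b. a \<in> sphere 0 1 \<and> (\<forall>l\<in>{1..k}. \<forall>i\<in>{1..n}.
      (\<Sum>h\<in>H. inverse (\<phi> l i h) * \<mu> i (voronoi_region G a b (g l * h))) = 0)"
  proof (rule voronoi_equipartition)
    show "\<exists>x\<in>cball 0 1. F x = 0"
      if "p \<ge> 2" "primitive_root p z" "\<And>j. primitive_root p (h j)" "continuous_on (cball 0 1) F"
        "\<And>x. norm x = 1 \<Longrightarrow> F (z *s x) = (\<chi> j. h j * F x $ j)"
      for p z h and F :: "complex ^ 'm \<Rightarrow> complex ^ 'm"
      using that by (rule equivariant_zero_complex)
  qed (use * in blast)+
next
  fix G :: "quat set" and H k n g and \<mu> :: "nat \<Rightarrow> (quat ^ 'm) set \<Rightarrow> quat" and \<phi>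
  assume *: "finite G" "subgroup G unit_sphere_group" "subgroup H (mult_monoid G)" "H \<noteq> {1}"
    "left_coset_reps (mult_monoid G) H k g" "CARD('m) = k * n"
    "\<forall>i\<in>{1..n}. mass_distribution (\<mu> i)"
    "\<forall>l\<in>{1..k}. \<forall>i\<in>{1..n}. \<phi> l i \<in> iso (mult_monoid H) (mult_monoid H)"
  show "\<exists>a b. a \<in> sphere 0 1 \<and> (\<forall>l\<in>{1..k}. \<forall>i\<in>{1..n}.
      (\<Sum>h\<in>H. inverse (\<phi> l i h) * \<mu> i (voronoi_region G a b (g l * h))) = 0)"
  proof (rule voronoi_equipartition)
    show "\<exists>x\<in>cball 0 1. F x = 0"
      if "p \<ge> 2" "primitive_root p z" "\<And>j. primitive_root p (h j)" "continuous_on (cball 0 1) F"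
        "\<And>x. norm x = 1 \<Longrightarrow> F (z *s x) = (\<chi> j. h j * F x $ j)"
      for p z h and F :: "quat ^ 'm \<Rightarrow> quat ^ 'm"
      using that by (rule equivariant_zero_quat)
  qed (use * in blast)+
qed

end
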